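(* Let $w\in\mathcal S_n$. Then $$\mathcal H_w(x;y)=\sum_{R\in\mathcal R(w)}\ \prod_{(i,j)\in R}(x_i+y_j-x_iy_j)\prod_{\substack{(i,j)\notin R\sqcup\mathrm{rabs}(R)\\ i+j\le n}}(1-x_i)(1-y_j).$$ The same formula holds with $\mathrm{rabs}(R)$ replaced by $\mathrm{labs}(R)$.
   Context: $s_i$ is the transposition of $i,i+1$, products of permutations are compositions $(uv)(i)=u(v(i))$, $\omega_0=[n,n-1,\dots,1]\in\mathcal S_n$. Double $\mathcal H$-polynomials (for fixed $n$): $s_i$ acts on polynomials in $x_1,\dots,x_n,y_1,\dots,y_n$ by exchanging $x_i,x_{i+1}$. Let $\pi_i f=\dfrac{(1-x_{i+1})f-s_i((1-x_{i+1})f)}{x_i-x_{i+1}}$, $\mu_i=\pi_i-1$, and $\mu_v=\mu_{i_1}\cdots\mu_{i_r}$ for any reduced word $v=s_{i_1}\cdots s_{i_r}$. Then $\mathcal H_{\omega_0}(x;y)=\prod_{i+j\le n}(x_i+y_j-x_iy_j)$ and $\mathcal H_w(x;y)=\mu_{w^{-1}\omega_0}\mathcal H_{\omega_0}(x;y)$. Rc-graphs: consider subsets $R$ of $\{(i,j)\in\mathbb Z_{>0}^2\mid i+j\le n\}$ ($i$ is the row, numbered from top to bottom, and $j$ the column, numbered from left to right). Order the positions by $(i,j)\le(i',j')$ iff $i<i'$, or $i=i'$ and $j\ge j'$. If $(i_k,j_k)$ is the $k$-th element of $R$ in this order, let $a_k=i_k+j_k-1$. $R$ is an rc-graph for $w$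 if $(a_1,a_2,\dots)$ is a reduced word for $w$, i.e. $w=s_{a_1}s_{a_2}\cdots$ with $\#R=\ell(w)$. $\mathcal R(w)$ is the set of rc-graphs for $w$. Draw $R$ with $n$ lines going up and to the right, the $i$-th line starting at position $(i,1)$ from the left and ending at the top of column $w_i$: the two lines meeting at $(i,j)$ cross (one horizontal, one vertical) if $(i,j)\in R$; otherwise they avoid each other (the line entering from the left turns up, the line entering from below turns right). A position $(i,j)\notin R$ with $i+j\le n$ is right absorbable (respectively left absorbable) if the two lines avoiding each other at $(i,j)$ cross in another position, northeast (respectively southwest) of $(i,j)$. $\mathrm{rabs}(R)$ and $\mathrm{labs}(R)$ are the sets of right and left absorbable positions of $R$. *)

theory Defs
  imports "HOL-Library.Poly_Mapping" "HOL-Combinatorics.Permutations"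
begin

text \<open>Polynomials with integer coefficients in variables \<open>Xvar 1, Xvar 2, \<dots>\<close> and
  \<open>Yvar 1, Yvar 2, \<dots>\<close>, as finitely supported maps from monomials (exponent maps) to
  coefficients.\<close>

datatype xyvar = Xvar nat | Yvar nat

type_synonym xypoly = "(xyvar \<Rightarrow>\<^sub>0 nat) \<Rightarrow>\<^sub>0 int"

text \<open>The order on the variables plays no mathematical role: it only provides the
  class instance that makes \<open>xypoly\<close> an integral domain.\<close>

fun xyvar_rank :: "xyvar \<Rightarrow> nat" where
  "xyvar_rank (Xvar i) = 2 * i"
| "xyvar_rank (Yvar j) = 2 * j + 1"

lemma xyvar_rank_inject: "xyvar_rank u = xyvar_rank v \<Longrightarrow> u = v"
  by (cases u; cases v) (simp_all, presburger+)

instantiation xyvar :: linorder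
begin

definition less_eq_xyvar :: "xyvar \<Rightarrow> xyvar \<Rightarrow> bool" where
  "u \<le> v \<longleftrightarrow> xyvar_rank u \<le> xyvar_rank v"

definition less_xyvar :: "xyvar \<Rightarrow> xyvar \<Rightarrow> bool" where
  "u < v \<longleftrightarrow> xyvar_rank u < xyvar_rank v"

instance
  by standard (auto simp: less_eq_xyvar_def less_xyvar_def intro: xyvar_rank_inject)

end

definition var :: "xyvar \<Rightarrow> xypoly" where
  "var v = Poly_Mapping.single (Poly_Mapping.single v 1) 1"

abbreviation xv :: "nat \<Rightarrow> xypoly" where "xv i \<equiv> var (Xvar i)"
abbreviation yv :: "nat \<Rightarrow> xypoly" where "yv j \<equiv> var (Yvar j)"

abbreviation s_perm :: "nat \<Rightarrow> nat \<Rightarrow> nat" where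
  "s_perm i \<equiv> Transposition.transpose i (i + 1)"

text \<open>The inner \<open>map_key\<close> exchanges \<open>Xvar i\<close> and \<open>Xvar (i + 1)\<close> in a monomial; the outer
  one applies this to all monomials of \<open>f\<close>. Both reindexings are involutions, so
  there is no difference between acting by a map and by its inverse.\<close>

definition s_act :: "nat \<Rightarrow> xypoly \<Rightarrow> xypoly" where
  "s_act i f =
     Poly_Mapping.map_key (Poly_Mapping.map_key (Transposition.transpose (Xvar i) (Xvar (i + 1)))) f"

text \<open>\<open>pi_op i f\<close> is the quotient by \<open>xv i - xv (i + 1)\<close>, a nonzero element of
  an integral domain; the division is exact.\<close>

definition pi_op :: "nat \<Rightarrow> xypoly \<Rightarrow> xypoly" where
  "pi_op i f = (THE g. (xv i - xv (i + 1)) * g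
       = (1 - xv (i + 1)) * f - s_act i ((1 - xv (i + 1)) * f))"

definition mu :: "nat \<Rightarrow> xypoly \<Rightarrow> xypoly" where
  "mu i f = pi_op i f - f"

definition mu_word :: "nat list \<Rightarrow> xypoly \<Rightarrow> xypoly" where
  "mu_word as f = foldr mu as f"

definition word_perm :: "nat list \<Rightarrow> nat \<Rightarrow> nat" where
  "word_perm as = foldr (\<lambda>a v. s_perm a \<circ> v) as id"

text \<open>Elements of the symmetric group on \<open>{1..n}\<close> are functions \<open>w\<close> with
  \<open>w permutes {1..n}\<close>.\<close>

definition perm_length :: "nat \<Rightarrow> (nat \<Rightarrow> nat) \<Rightarrow> nat" where
  "perm_length n w = (LEAST k. \<exists>as. set as \<subseteq> {1..<n} \<and> word_perm as = w \<and> length as = k)"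

definition reduced_word :: "nat \<Rightarrow> (nat \<Rightarrow> nat) \<Rightarrow> nat list \<Rightarrow> bool" where
  "reduced_word n w as \<longleftrightarrow>
     set as \<subseteq> {1..<n} \<and> word_perm as = w \<and> length as = perm_length n w"

text \<open>The common value of \<open>mu_word as f\<close> over all reduced words \<open>as\<close> of \<open>v\<close>.\<close>

definition mu_perm :: "nat \<Rightarrow> (nat \<Rightarrow> nat) \<Rightarrow> xypoly \<Rightarrow> xypoly" where
  "mu_perm n v f = (THE g. \<forall>as. reduced_word n v as \<longrightarrow> g = mu_word as f)"

definition omega0 :: "nat \<Rightarrow> nat \<Rightarrow> nat" where
  "omega0 n i = (if i \<in> {1..n} then n + 1 - i else i)"

definition staircase :: "nat \<Rightarrow> (nat \<times> nat) set" where
  "staircase n = {(i, j). 1 \<le> i \<and> 1 \<le> j \<and> i + j \<le> n}"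

definition H_omega0 :: "nat \<Rightarrow> xypoly" where
  "H_omega0 n = (\<Prod>(i, j)\<in>staircase n. xv i + yv j - xv i * yv j)"

definition H_poly :: "nat \<Rightarrow> (nat \<Rightarrow> nat) \<Rightarrow> xypoly" where
  "H_poly n w = mu_perm n (inv w \<circ> omega0 n) (H_omega0 n)"

text \<open>The numbers \<open>i + j - 1\<close> for \<open>(i, j)\<close> in \<open>R\<close>, read row by row from top to bottom
  and from right to left in each row.\<close>

definition reading_word :: "nat \<Rightarrow> (nat \<times> nat) set \<Rightarrow> nat list" where
  "reading_word n R = [i + j - 1. i \<leftarrow> [1..<n], j \<leftarrow> rev [1..<n], (i, j) \<in> R]"

definition rc_graphs :: "nat \<Rightarrow> (nat \<Rightarrow> nat) \<Rightarrow> (nat \<times> nat) set set" where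
  "rc_graphs n w = {R. R \<subseteq> staircase n \<and> reduced_word n w (reading_word n R)}"

datatype entry = From_left | From_below

text \<open>\<open>line n R k i j d\<close>: the \<open>k\<close>-th of the \<open>n\<close> lines drawn for \<open>R\<close> enters position
  \<open>(i, j)\<close> from the side \<open>d\<close>. A line leaving row 1 upwards ends at the top of its
  column, so row 0 is never entered.\<close>

inductive line :: "nat \<Rightarrow> (nat \<times> nat) set \<Rightarrow> nat \<Rightarrow> nat \<Rightarrow> nat \<Rightarrow> entry \<Rightarrow> bool"
  for n R k where
  start: "k \<in> {1..n} \<Longrightarrow> line n R k k 1 From_left"
| cross_left: "line n R k i j From_left \<Longrightarrow> (i, j) \<in> R \<Longrightarrow> line n R k i (j + 1) From_left"
| cross_below: "line n R k i j From_below \<Longrightarrow> (i, j) \<in> R \<Longrightarrow> i > 1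
    \<Longrightarrow> line n R k (i - 1) j From_below"
| avoid_left: "line n R k i j From_left \<Longrightarrow> (i, j) \<notin> R \<Longrightarrow> i > 1
    \<Longrightarrow> line n R k (i - 1) j From_below"
| avoid_below: "line n R k i j From_below \<Longrightarrow> (i, j) \<notin> R \<Longrightarrow> line n R k i (j + 1) From_left"

definition meet_at :: "nat \<Rightarrow> (nat \<times> nat) set \<Rightarrow> nat \<Rightarrow> nat \<Rightarrow> nat \<Rightarrow> nat \<Rightarrow> bool" where
  "meet_at n R a b i j \<longleftrightarrow>
     line n R a i j From_left \<and> line n R b i j From_below \<or>
     line n R b i j From_left \<and> line n R a i j From_below"

definition cross_at :: "nat \<Rightarrow> (nat \<times> nat) set \<Rightarrow> nat \<Rightarrow> nat \<Rightarrow> nat \<Rightarrow> nat \<Rightarrow> bool" where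
  "cross_at n R a b i j \<longleftrightarrow> (i, j) \<in> R \<and> meet_at n R a b i j"

text \<open>Rows are numbered downwards, so northeast of \<open>(i, j)\<close> means a smaller row and a larger
  column. Strict inequalities in both coordinates lose nothing: of two lines avoiding each
  other at \<open>(i, j)\<close>, one comes from the left and leaves row \<open>i\<close> upwards, and the
  other comes from below and leaves column \<open>j\<close> to the right.\<close>

definition rabs :: "nat \<Rightarrow> (nat \<times> nat) set \<Rightarrow> (nat \<times> nat) set" where
  "rabs n R = {(i, j) \<in> staircase n - R.
     \<exists>a b i' j'. meet_at n R a b i j \<and> cross_at n R a b i' j' \<and> i' < i \<and> j' > j}"

definition labs :: "nat \<Rightarrow> (nat \<times> nat) set \<Rightarrow> (nat \<times> nat) set" where
  "labs n R = {(i, j) \<in> staircase n - R.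
     \<exists>a b i' j'. meet_at n R a b i j \<and> cross_at n R a b i' j' \<and> i' > i \<and> j' < j}"

end

theory Submission
  imports Defs
begin

text \<open>Put \<open>c i j = xv i + yv j - xv i * yv j\<close>, so that \<open>1 - c i j = (1 - xv i) * (1 - yv j)\<close>.
Treat \<open>c i j\<close> as if it were the probability that a crossing is put at \<open>(i, j)\<close>,
independently for all positions of the staircase. The word read from the chosen set \<open>S\<close> of
crossings has a product in the 0-Hecke monoid (its Demazure product), where a letter is ignored
when it would shorten the permutation. Let \<open>subword_sum n w\<close> be the probability that this
product is \<open>w\<close>, that is, the sum over all such \<open>S\<close> of
\<open>(\<Prod>p\<in>S. c p) * (\<Prod>p\<notin>S. 1 - c p)\<close>. Both formulas come from computing this one
polynomial in different ways.

It is the double H-polynomial (\<open>H_poly_eq_subword_sum\<close>). Reaching the longest permutation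
requires all crossings, which gives the product defining \<open>H_omega0\<close>. For the recursion
(\<open>mu_subword_sum\<close>), the Yang--Baxter equation in the 0-Hecke algebra
(\<open>yang_baxter\<close>) shows that exchanging the variables of two neighbouring rows amounts to
inserting one more factor \<open>(1 - xv (a + 1)) + (xv (a + 1) - xv a) T\<^sub>a\<close> after the last row,
up to the scalar \<open>1 - xv a\<close> (\<open>expect_exchange\<close>). Reading off coefficients gives
\<open>mu a (subword_sum n w) = subword_sum n (w \<circ> s_perm a)\<close> whenever \<open>w\<close> has a descent at
\<open>a\<close>. Following any reduced word down from the longest permutation then gives
\<open>H_poly n w = subword_sum n w\<close>.

It is also the sum over rc-graphs (\<open>expect_point\<close>). Read the positions in order and keep
only the crossings of \<open>S\<close> that lengthen the current permutation; the result is a reduced set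
\<open>R\<close>. Conversely, from \<open>R\<close> one gets exactly the sets \<open>S\<close> that add to it any positions
at which a crossing would have been ignored. Each position of this kind contributes
\<open>c p + (1 - c p) = 1\<close>, so only the other positions outside \<open>R\<close> leave a factor
\<open>1 - c p\<close>. A crossing is ignored at a position exactly when the two lines through it have
crossed among the positions read before, which lie to the northeast: these positions form
\<open>rabs n R\<close>. Since the Demazure product can be evaluated from either end of the word
(\<open>expect_rev\<close>), the same argument applies to the reversed reading order, where the crossings
read before lie to the southwest and one finds \<open>labs n R\<close>.\<close>

section \<open>The 0-Hecke action and the exchange of two rows\<close>

text \<open>The right action of the generator with index \<open>a\<close> of the 0-Hecke monoid: it puts the values
at \<open>a\<close> and \<open>a + 1\<close> into decreasing order. Read as sorting, it makes sense for every map,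
so that the monoid relations below need no assumption on \<open>u\<close>.\<close>

definition demazure :: "nat \<Rightarrow> (nat \<Rightarrow> nat) \<Rightarrow> nat \<Rightarrow> nat" where
  "demazure a u = (if u a < u (a + 1) then u \<circ> s_perm a else u)"

lemma demazure_idem: "demazure a (demazure a u) = demazure a u"
  by (auto simp: demazure_def)

text \<open>Both sides sort the values at \<open>a, a + 1, a + 2\<close> into decreasing order.\<close>

lemma demazure_braid:
  "demazure a (demazure (a + 1) (demazure a u)) = demazure (a + 1) (demazure a (demazure (a + 1) u))"
proof -
  have braid: "s_perm a \<circ> (s_perm (a + 1) \<circ> s_perm a) = s_perm (a + 1) \<circ> (s_perm a \<circ> s_perm (a + 1))"
    by (rule ext) (auto simp: Transposition.transpose_def)
  have vals: "s_perm a a = a + 1" "s_perm a (a + 1) = a" "s_perm a (a + 2) = a + 2"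
    "s_perm (a + 1) a = a" "s_perm (a + 1) (a + 1) = a + 2" "s_perm (a + 1) (a + 2) = a + 1"
    by (auto simp: Transposition.transpose_def)
  show ?thesis
    using vals braid
    by (auto simp: demazure_def o_assoc[symmetric] add.assoc)
qed

lemma demazure_commute:
  assumes "a + 1 < b"
  shows "demazure a (demazure b u) = demazure b (demazure a u)"
proof -
  have commute: "s_perm a \<circ> s_perm b = s_perm b \<circ> s_perm a"
    using assms by (intro ext) (auto simp: Transposition.transpose_def)
  have vals: "s_perm a b = b" "s_perm a (b + 1) = b + 1" "s_perm b a = a" "s_perm b (a + 1) = a + 1"
    using assms by (auto simp: Transposition.transpose_def)
  show ?thesis
    using vals commute by (auto simp: demazure_def o_assoc[symmetric])
qed

text \<open>The element \<open>p + q T\<^sub>a\<close> of the 0-Hecke algebra, acting on functions of permutations by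
\<open>T\<^sub>a \<phi> = \<phi> \<circ> demazure a\<close>. In a composition of such operators, evaluated at \<open>id\<close>, the
outermost operator acts on the permutation first and so belongs to the first letter of the word.\<close>

definition hecke_op :: "nat \<Rightarrow> 'a::comm_ring_1 \<Rightarrow> 'a \<Rightarrow> ((nat \<Rightarrow> nat) \<Rightarrow> 'a) \<Rightarrow> (nat \<Rightarrow> nat) \<Rightarrow> 'a" where
  "hecke_op a p q \<phi> u = p * \<phi> u + q * \<phi> (demazure a u)"

lemma hecke_op_commute:
  assumes "a + 1 < b"
  shows "hecke_op a p q (hecke_op b r s \<phi>) = hecke_op b r s (hecke_op a p q \<phi>)"
  by (rule ext) (simp add: hecke_op_def demazure_commute[OF assms] algebra_simps)

lemma hecke_op_scale: "hecke_op a p q (\<lambda>u. c * \<phi> u) = (\<lambda>u. c * hecke_op a p q \<phi> u)"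
  by (rule ext) (simp add: hecke_op_def algebra_simps)

text \<open>Expanded in the 0-Hecke algebra, the two sides differ only in the coefficients of \<open>T\<^sub>a\<close> and
\<open>T\<^sub>a\<^sub>+\<^sub>1\<close>, and the hypothesis makes these equal. If each factor \<open>p + q T\<close> is
normalised to \<open>(1 - c) + c T\<close> with \<open>c = q / (p + q)\<close>, the hypothesis reads
\<open>c\<^sub>2 = c\<^sub>1 + c\<^sub>3 - c\<^sub>1 * c\<^sub>3\<close>; the stated form avoids denominators.\<close>

lemma yang_baxter:
  fixes p1 q1 p2 q2 p3 q3 :: "'a::comm_ring_1"
  assumes "p2 * (q1 * p3 + p1 * q3 + q1 * q3) = q2 * p1 * p3"
  shows "hecke_op a p1 q1 (hecke_op (a + 1) p2 q2 (hecke_op a p3 q3 \<phi>)) =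
    hecke_op (a + 1) p3 q3 (hecke_op a p2 q2 (hecke_op (a + 1) p1 q1 \<phi>))" (is "?L = ?R")
proof (rule ext)
  fix u
  have "?L u = p1 * p2 * p3 * \<phi> u + p2 * (q1 * p3 + p1 * q3 + q1 * q3) * \<phi> (demazure a u)
    + p1 * q2 * p3 * \<phi> (demazure (a + 1) u) + q1 * q2 * p3 * \<phi> (demazure (a + 1) (demazure a u))
    + p1 * q2 * q3 * \<phi> (demazure a (demazure (a + 1) u))
    + q1 * q2 * q3 * \<phi> (demazure a (demazure (a + 1) (demazure a u)))"
    by (simp add: hecke_op_def demazure_idem algebra_simps)
  moreover have "?R u = p1 * p2 * p3 * \<phi> u + p2 * (q1 * p3 + p1 * q3 + q1 * q3) * \<phi> (demazure (a + 1) u)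
    + p1 * q2 * p3 * \<phi> (demazure a u) + q1 * q2 * p3 * \<phi> (demazure (a + 1) (demazure a u))
    + p1 * q2 * q3 * \<phi> (demazure a (demazure (a + 1) u))
    + q1 * q2 * q3 * \<phi> (demazure (a + 1) (demazure a (demazure (a + 1) u)))"
    by (simp add: hecke_op_def demazure_idem algebra_simps)
  ultimately show "?L u = ?R u"
    unfolding assms demazure_braid by (simp add: mult_ac)
qed

text \<open>The multiplicative formal group law; \<open>1 - (x \<oplus> y) = (1 - x) * (1 - y)\<close>.\<close>

abbreviation (input) formal_sum :: "'a::comm_ring_1 \<Rightarrow> 'a \<Rightarrow> 'a" (infixl "\<oplus>" 65) where
  "x \<oplus> y \<equiv> x + y - x * y"

definition cross_op :: "nat \<Rightarrow> 'a::comm_ring_1 \<Rightarrow> ((nat \<Rightarrow> nat) \<Rightarrow> 'a) \<Rightarrow> (nat \<Rightarrow> nat) \<Rightarrow> 'a" where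
  "cross_op a c = hecke_op a (1 - c) c"

text \<open>One row of crossings with row variable \<open>x\<close> and column variables listed from left to right;
the leftmost column has letter \<open>a\<close>. As rows are read from right to left, the leftmost column is
the innermost operator.\<close>

fun row_op :: "'a::comm_ring_1 \<Rightarrow> nat \<Rightarrow> 'a list \<Rightarrow> ((nat \<Rightarrow> nat) \<Rightarrow> 'a) \<Rightarrow> (nat \<Rightarrow> nat) \<Rightarrow> 'a" where
  "row_op x a [] \<phi> = \<phi>"
| "row_op x a (y # ys) \<phi> = row_op x (a + 1) ys (cross_op a (x \<oplus> y) \<phi>)"

lemma row_op_hecke_op_commute:
  assumes "a + 1 < b"
  shows "row_op x b ys (hecke_op a p q \<phi>) = hecke_op a p q (row_op x b ys \<phi>)"
  using assms
proof (induction ys arbitrary: b \<phi>)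
  case (Cons y ys)
  then show ?case
    by (simp add: cross_op_def hecke_op_commute[OF Cons.prems, symmetric])
qed simp

text \<open>The factor \<open>(1 - x') + (x' - x) T\<^sub>a\<close> is \<open>1 - x\<close> times a crossing whose parameter is the
difference of \<open>x'\<close> and \<open>x\<close> for the group law \<open>\<oplus>\<close>. Together with the crossings of the
two rows in the leftmost column it matches the Yang--Baxter equation, which moves it to the other side
of that column, where it becomes the same factor for \<open>a + 1\<close>. Induction over the columns moves it
through both rows, exchanging the row variables on the way; the last column, which meets only the
upper row, absorbs it.\<close>

lemma row_op_exchange:
  fixes x x' :: "'a::comm_ring_1"
  assumes "ys \<noteq> []"
  shows "row_op x a ys (row_op x' (a + 1) (butlast ys) (hecke_op a (1 - x') (x' - x) \<phi>)) =
    (\<lambda>u. (1 - x) * row_op x' a ys (row_op x (a + 1) (butlast ys) \<phi>) u)"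
  using assms
proof (induction ys arbitrary: a \<phi>)
  case Nil
  then show ?case by simp
next
  case (Cons y zs)
  show ?case
  proof (cases "zs = []")
    case True
    then show ?thesis
      by (auto simp: cross_op_def hecke_op_def demazure_idem algebra_simps)
  next
    case False
    have yb: "cross_op a (x \<oplus> y) (cross_op (a + 1) (x' \<oplus> y) (hecke_op a (1 - x') (x' - x) \<phi>)) =
      hecke_op (a + 1) (1 - x') (x' - x) (cross_op a (x' \<oplus> y) (cross_op (a + 1) (x \<oplus> y) \<phi>))"
      unfolding cross_op_def by (rule yang_baxter) (simp add: algebra_simps)
    \<comment> \<open>The rest of the lower row has letters at least \<open>a + 2\<close>, so the leftmost crossing of the
      upper row can be moved past it.\<close>
    have comm: "cross_op a c (row_op t (Suc (Suc a)) (butlast zs) \<psi>) = row_op t (Suc (Suc a)) (butlast zs) (cross_op a c \<psi>)" for c t \<psi>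
      unfolding cross_op_def by (rule row_op_hecke_op_commute[symmetric]) simp
    show ?thesis
      using False yb Cons.IH[OF False, of "a + 1"] by (simp add: comm)
  qed
qed

section \<open>The operators on polynomials\<close>

definition mono_swap :: "nat \<Rightarrow> (xyvar \<Rightarrow>\<^sub>0 nat) \<Rightarrow> (xyvar \<Rightarrow>\<^sub>0 nat)" where
  "mono_swap i = Poly_Mapping.map_key (Transposition.transpose (Xvar i) (Xvar (i + 1)))"

lemma s_act_conv: "s_act i = Poly_Mapping.map_key (mono_swap i)"
  by (simp add: s_act_def mono_swap_def fun_eq_iff)

lemma mono_swap_mono_swap [simp]: "mono_swap i (mono_swap i m) = m"
  by (simp add: mono_swap_def map_key_compose map_key_id[folded id_def])

lemma inj_mono_swap: "inj (mono_swap i)"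
  by (metis injI mono_swap_mono_swap)

lemma mono_swap_add: "mono_swap i (m + m') = mono_swap i m + mono_swap i m'"
  by (simp add: mono_swap_def map_key_plus)

lemma s_act_single: "s_act i (Poly_Mapping.single m c) = Poly_Mapping.single (mono_swap i m) c"
  unfolding s_act_conv using map_key_single[OF inj_mono_swap, of i "mono_swap i m" c] by simp

lemma s_act_add: "s_act i (f + g) = s_act i f + s_act i g"
  unfolding s_act_conv by (rule map_key_plus[OF inj_mono_swap])

lemma xypoly_induct [case_names zero single_add]:
  fixes P :: "xypoly \<Rightarrow> bool"
  assumes "P 0" and "\<And>m c f. P f \<Longrightarrow> P (Poly_Mapping.single m c + f)"
  shows "P f"
proof (induction f rule: update_induct)
  case const
  then show ?case by (rule assms)
next
  case (update f m c)
  have "Poly_Mapping.update m c f = Poly_Mapping.single m c + f"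
    using update.hyps
    by (intro poly_mapping_eqI)
      (auto simp: Poly_Mapping.lookup_update lookup_add lookup_single in_keys_iff when_def)
  then show ?case
    using assms(2)[OF update.IH] by simp
qed

lemma s_act_0: "s_act i 0 = 0"
  using s_act_add[of i 0 0] by simp

text \<open>By bilinearity it suffices to compare both sides on single monomials.\<close>

lemma s_act_mult: "s_act i (f * g) = s_act i f * s_act i g"
proof (induction f rule: xypoly_induct)
  case zero
  then show ?case by (simp add: s_act_0)
next
  case (single_add m c f)
  have "s_act i (Poly_Mapping.single m c * g) = s_act i (Poly_Mapping.single m c) * s_act i g"
  proof (induction g rule: xypoly_induct)
    case zero
    then show ?case by (simp add: s_act_0)
  next
    case (single_add m' c' g)
    then show ?case
      by (simp add: distrib_left s_act_add mult_single s_act_single mono_swap_add)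
  qed
  then show ?case
    using single_add by (simp add: distrib_right s_act_add)
qed

lemma s_act_1: "s_act i 1 = 1"
  using s_act_single[of i 0 1] by (simp add: mono_swap_def)

lemma s_act_diff: "s_act i (f - g) = s_act i f - s_act i g"
  using s_act_add[of i "f - g" g] by simp

lemma s_act_var: "s_act i (var v) = var (Transposition.transpose (Xvar i) (Xvar (i + 1)) v)"
proof -
  let ?t = "Transposition.transpose (Xvar i) (Xvar (i + 1))"
  have "Poly_Mapping.map_key ?t (Poly_Mapping.single v (1::nat)) = Poly_Mapping.single (?t v) 1"
    using map_key_single[of ?t "?t v" "1::nat"] by simp
  then show ?thesis by (simp add: var_def s_act_single mono_swap_def)
qed

lemma s_act_xv: "s_act i (xv j) = xv (s_perm i j)"
  by (auto simp: s_act_var Transposition.transpose_def)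

lemma s_act_yv: "s_act i (yv j) = yv j"
  by (auto simp: s_act_var Transposition.transpose_def)

lemma xv_diff_nonzero: "xv i - xv (i + 1) \<noteq> 0"
proof
  let ?m = "\<lambda>k. Poly_Mapping.single (Xvar k) (1::nat)"
  assume "xv i - xv (i + 1) = 0"
  then have "Poly_Mapping.keys (xv i) = Poly_Mapping.keys (xv (i + 1))"
    by simp
  then have "?m i = ?m (i + 1)"
    by (simp add: var_def)
  then have "Poly_Mapping.keys (?m i) = Poly_Mapping.keys (?m (i + 1))"
    by simp
  then show False
    by simp
qed

text \<open>The quotient in \<open>pi_op\<close> is characterised without division, because the ring of polynomials is an
integral domain.\<close>

lemma mu_eqI:
  assumes "(xv i - xv (i + 1)) * (f + g) = (1 - xv (i + 1)) * f - s_act i ((1 - xv (i + 1)) * f)"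
  shows "mu i f = g"
proof -
  have "pi_op i f = f + g"
    unfolding pi_op_def
  proof (rule the_equality)
    show "(xv i - xv (i + 1)) * (f + g) = (1 - xv (i + 1)) * f - s_act i ((1 - xv (i + 1)) * f)"
      by (rule assms)
  next
    fix h
    assume "(xv i - xv (i + 1)) * h = (1 - xv (i + 1)) * f - s_act i ((1 - xv (i + 1)) * f)"
    then have "(xv i - xv (i + 1)) * h = (xv i - xv (i + 1)) * (f + g)"
      by (simp only: assms)
    then show "h = f + g"
      using mult_left_cancel[OF xv_diff_nonzero[of i]] by blast
  qed
  then show ?thesis by (simp add: mu_def)
qed

section \<open>Inversions and reduced words\<close>

definition inversions :: "nat \<Rightarrow> (nat \<Rightarrow> nat) \<Rightarrow> (nat \<times> nat) set" where
  "inversions n u = {(i, j). 1 \<le> i \<and> i < j \<and> j \<le> n \<and> u j < u i}"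

lemma finite_inversions: "finite (inversions n u)"
  by (rule finite_subset[of _ "{1..n} \<times> {1..n}"]) (auto simp: inversions_def)

text \<open>Exchanging the entries at \<open>a\<close> and \<open>a + 1\<close> moves the inversions of \<open>u\<close> along
\<open>s_perm a\<close> in both coordinates and creates the single new one \<open>(a, a + 1)\<close>.\<close>

lemma inversions_ascent:
  assumes "a \<in> {1..<n}" "u a < u (a + 1)"
  shows "card (inversions n (u \<circ> s_perm a)) = card (inversions n u) + 1"
proof -
  let ?s = "s_perm a"
  have inj: "inj_on (map_prod ?s ?s) A" for A
    by (intro inj_on_subset[OF map_prod_inj_on[of _ UNIV _ UNIV]]) auto
  have "inversions n (u \<circ> ?s) = insert (a, a + 1) (map_prod ?s ?s ` inversions n u)"
  proof (rule set_eqI)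
    fix p :: "nat \<times> nat"
    obtain i j where p: "p = (i, j)" by (cases p)
    have "p \<in> map_prod ?s ?s ` inversions n u \<longleftrightarrow> (?s i, ?s j) \<in> inversions n u"
      unfolding p by (force simp: image_iff intro: bexI[of _ "(?s i, ?s j)"])
    then show "p \<in> inversions n (u \<circ> ?s) \<longleftrightarrow> p \<in> insert (a, a + 1) (map_prod ?s ?s ` inversions n u)"
      using assms unfolding p
      by (auto simp: inversions_def Transposition.transpose_def split: if_splits)
  qed
  moreover have "(a, a + 1) \<notin> map_prod ?s ?s ` inversions n u"
    using assms by (auto simp: inversions_def Transposition.transpose_def split: if_splits)
  ultimately show ?thesis
    using inj by (simp add: finite_inversions card_image)
qed

lemma inversions_descent:
  assumes "a \<in> {1..<n}" "u (a + 1) < u a"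
  shows "card (inversions n u) = card (inversions n (u \<circ> s_perm a)) + 1"
  using inversions_ascent[of a n "u \<circ> s_perm a"] assms by (simp add: o_assoc[symmetric])

lemma word_perm_Nil [simp]: "word_perm [] = id"
  by (simp add: word_perm_def)

lemma word_perm_Cons [simp]: "word_perm (a # as) = s_perm a \<circ> word_perm as"
  by (simp add: word_perm_def)

lemma word_perm_append [simp]: "word_perm (as @ bs) = word_perm as \<circ> word_perm bs"
  by (induction as) auto

lemma bij_word_perm: "bij (word_perm as)"
  by (induction as) (simp_all only: word_perm_Nil word_perm_Cons bij_id bij_comp bij_transpose)

lemma inv_word_perm: "inv (word_perm as) = word_perm (rev as)"
proof (rule inv_unique_comp)
  show "word_perm as \<circ> word_perm (rev as) = id"
    by (induction as) (auto simp: fun_eq_iff)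
  show "word_perm (rev as) \<circ> word_perm as = id"
    by (induction as) (auto simp: fun_eq_iff)
qed

lemma word_perm_fixed: "(\<And>a. a \<in> set as \<Longrightarrow> k \<noteq> a \<and> k \<noteq> a + 1) \<Longrightarrow> word_perm as k = k"
  by (induction as) auto

text \<open>Every letter of the word lengthens the permutation reached so far, starting from \<open>u\<close>. For
\<open>u = id\<close> this is reducedness, in a form that can be tested letter by letter.\<close>

fun rising :: "(nat \<Rightarrow> nat) \<Rightarrow> nat list \<Rightarrow> bool" where
  "rising u [] \<longleftrightarrow> True"
| "rising u (a # as) \<longleftrightarrow> u a < u (a + 1) \<and> rising (u \<circ> s_perm a) as"

lemma rising_append: "rising u (as @ bs) \<longleftrightarrow> rising u as \<and> rising (u \<circ> word_perm as) bs"
  by (induction as arbitrary: u) (auto simp: o_assoc)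

text \<open>Each letter changes the number of inversions by one, up or down, so the largest possible value is
reached exactly if all letters go up.\<close>

lemma card_inversions_word:
  assumes "inj u" "set as \<subseteq> {1..<n}"
  shows "card (inversions n (u \<circ> word_perm as)) \<le> card (inversions n u) + length as \<and>
    (card (inversions n (u \<circ> word_perm as)) = card (inversions n u) + length as \<longleftrightarrow> rising u as)"
  using assms
proof (induction as arbitrary: u)
  case (Cons a as)
  have a: "a \<in> {1..<n}"
    using Cons.prems by simp
  have IH: "card (inversions n (u \<circ> s_perm a \<circ> word_perm as)) \<le> card (inversions n (u \<circ> s_perm a)) + length as \<and>
    (card (inversions n (u \<circ> s_perm a \<circ> word_perm as)) = card (inversions n (u \<circ> s_perm a)) + length as
      \<longleftrightarrow> rising (u \<circ> s_perm a) as)"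
    using Cons.prems by (intro Cons.IH inj_compose) auto
  define k where "k = card (inversions n (u \<circ> s_perm a \<circ> word_perm as))"
  have u: "u \<circ> word_perm (a # as) = u \<circ> s_perm a \<circ> word_perm as"
    by (simp only: word_perm_Cons o_assoc)
  have "u a \<noteq> u (a + 1)"
    using Cons.prems by (simp add: inj_eq)
  then consider "u a < u (a + 1)" | "u (a + 1) < u a" by linarith
  then show ?case
  proof cases
    case 1
    then show ?thesis
      using IH inversions_ascent[OF a 1] unfolding u rising.simps k_def[symmetric] by auto
  next
    case 2
    then show ?thesis
      using IH inversions_descent[OF a 2] unfolding u rising.simps k_def[symmetric] by auto
  qed
qed simp

lemma inversions_id: "inversions n id = {}"
  by (auto simp: inversions_def)

text \<open>Increasing values force \<open>i \<le> w i\<close>; as both sides have the same sum over \<open>{1..n}\<close>, no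
inequality is strict.\<close>

lemma permutes_no_descent:
  fixes w :: "nat \<Rightarrow> nat"
  assumes "w permutes {1..n}" and "\<And>a. a \<in> {1..<n} \<Longrightarrow> w a < w (a + 1)"
  shows "w = id"
proof -
  have le: "i \<le> w i" if "i \<le> n" for i
    using that
  proof (induction i)
    case 0
    then show ?case by simp
  next
    case (Suc i)
    then show ?case
      using assms(2)[of i] permutes_in_image[OF assms(1), of "Suc i"] by (cases "i = 0") auto
  qed
  have "sum w {1..n} = sum id {1..n}"
    using sum.permute[OF assms(1), of id] by simp
  moreover have "sum id {1..n} < sum w {1..n}" if "i \<in> {1..n}" "w i \<noteq> i" for i
    using that le by (intro sum_strict_mono_ex1) (auto intro!: bexI[of _ i] simp: le_neq_implies_less)
  ultimately have "w i = i" if "i \<in> {1..n}" for i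
    using that by force
  then show ?thesis
    using permutes_not_in[OF assms(1)] by (auto simp: fun_eq_iff)
qed

text \<open>Bubble sort: split off a descent as the last letter until none is left.\<close>

lemma exists_rising_word:
  assumes "w permutes {1..n}"
  shows "\<exists>as. set as \<subseteq> {1..<n} \<and> word_perm as = w \<and> rising id as"
  using assms
proof (induction "card (inversions n w)" arbitrary: w rule: less_induct)
  case less
  show ?case
  proof (cases "\<forall>a \<in> {1..<n}. w a < w (a + 1)")
    case True
    then have "w = id"
      using permutes_no_descent[OF less.prems] by blast
    then show ?thesis by (intro exI[of _ "[]"]) simp
  next
    case False
    then obtain a where a: "a \<in> {1..<n}" "\<not> w a < w (a + 1)" by blast
    moreover have "w a \<noteq> w (a + 1)"
      using permutes_inj[OF less.prems] by (simp add: inj_eq)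
    ultimately have desc: "w (a + 1) < w a" by simp
    have perm: "w \<circ> s_perm a permutes {1..n}"
      using a less.prems by (auto intro!: permutes_compose permutes_swap_id)
    have "card (inversions n (w \<circ> s_perm a)) < card (inversions n w)"
      using inversions_descent[of a n w] a(1) desc by simp
    from less.hyps[OF this perm] obtain as where as: "set as \<subseteq> {1..<n}" "word_perm as = w \<circ> s_perm a" "rising id as"
      by blast
    then show ?thesis
      using a desc
      by (intro exI[of _ "as @ [a]"]) (auto simp: rising_append o_assoc[symmetric])
  qed
qed

lemma reduced_word_iff_rising:
  assumes "w permutes {1..n}"
  shows "reduced_word n w as \<longleftrightarrow> set as \<subseteq> {1..<n} \<and> word_perm as = w \<and> rising id as"
proof -
  have len: "card (inversions n w) \<le> length as" "card (inversions n w) = length as \<longleftrightarrow> rising id as"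
    if "set as \<subseteq> {1..<n}" "word_perm as = w" for as
    using card_inversions_word[of id as n] that by (auto simp: inversions_id)
  have "perm_length n w = card (inversions n w)"
    unfolding perm_length_def
  proof (rule Least_equality)
    show "\<exists>as. set as \<subseteq> {1..<n} \<and> word_perm as = w \<and> length as = card (inversions n w)"
      using exists_rising_word[OF assms] len by metis
  qed (use len in auto)
  then show ?thesis
    unfolding reduced_word_def using len(2) by metis
qed

lemma reduced_word_rev:
  assumes "reduced_word n w as"
  shows "reduced_word n (inv w) (rev as)"
proof -
  have w: "bij w" using assms bij_word_perm by (auto simp: reduced_word_def)
  have "perm_length n (inv w) = perm_length n w"
    unfolding perm_length_def
  proof (rule arg_cong[of _ _ Least], intro ext iffI)
    fix k
    assume "\<exists>as. set as \<subseteq> {1..<n} \<and> word_perm as = inv w \<and> length as = k"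
    then obtain as where "set as \<subseteq> {1..<n} \<and> word_perm as = inv w \<and> length as = k" ..
    then show "\<exists>as. set as \<subseteq> {1..<n} \<and> word_perm as = w \<and> length as = k"
      using w by (intro exI[of _ "rev as"]) (simp add: inv_word_perm[symmetric] inv_inv_eq)
  next
    fix k
    assume "\<exists>as. set as \<subseteq> {1..<n} \<and> word_perm as = w \<and> length as = k"
    then obtain as where "set as \<subseteq> {1..<n} \<and> word_perm as = w \<and> length as = k" ..
    then show "\<exists>as. set as \<subseteq> {1..<n} \<and> word_perm as = inv w \<and> length as = k"
      by (intro exI[of _ "rev as"]) (simp add: inv_word_perm[symmetric])
  qed
  then show ?thesis
    using assms by (simp add: reduced_word_def inv_word_perm[symmetric])
qed

section \<open>Subword sums over the staircase and their recursion\<close>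

fun letter :: "nat \<times> nat \<Rightarrow> nat" where
  "letter (i, j) = i + j - 1"

text \<open>The expected value of \<open>\<phi>\<close> at the permutation reached from a given one, when the positions of
the list are read in order and position \<open>p\<close> carries a crossing with probability \<open>c p\<close>.\<close>

fun expect :: "(nat \<times> nat \<Rightarrow> 'a::comm_ring_1) \<Rightarrow> (nat \<times> nat) list \<Rightarrow>
    ((nat \<Rightarrow> nat) \<Rightarrow> 'a) \<Rightarrow> (nat \<Rightarrow> nat) \<Rightarrow> 'a" where
  "expect c [] \<phi> = \<phi>"
| "expect c (p # ps) \<phi> = cross_op (letter p) (c p) (expect c ps \<phi>)"

lemma expect_append: "expect c (ps @ qs) \<phi> = expect c ps (expect c qs \<phi>)"
  by (induction ps) auto

lemma expect_scale: "expect c ps (\<lambda>u. k * \<phi> u) = (\<lambda>u. k * expect c ps \<phi> u)"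
  by (induction ps) (simp_all add: cross_op_def hecke_op_scale)

lemma expect_add: "expect c ps (\<lambda>u. \<phi> u + \<psi> u) u = expect c ps \<phi> u + expect c ps \<psi> u"
  by (induction ps arbitrary: u) (simp_all add: cross_op_def hecke_op_def algebra_simps)

lemma expect_hecke_op: "expect c ps (hecke_op a k l \<phi>) u = k * expect c ps \<phi> u + l * expect c ps (\<lambda>u. \<phi> (demazure a u)) u"
  unfolding hecke_op_def[abs_def] expect_add expect_scale ..

lemma expect_cong:
  "(\<And>p. p \<in> set ps \<Longrightarrow> c p = c' p) \<Longrightarrow> expect c ps \<phi> = expect c' ps \<phi>"
  by (induction ps) auto

lemma expect_hecke_op_commute:
  assumes "\<And>p. p \<in> set ps \<Longrightarrow> a + 1 < letter p"
  shows "expect c ps (hecke_op a k l \<phi>) = hecke_op a k l (expect c ps \<phi>)"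
  using assms
proof (induction ps)
  case (Cons p ps)
  then show ?case
    by (simp add: cross_op_def hecke_op_commute[of a "letter p", symmetric])
qed simp

definition row_positions :: "nat \<Rightarrow> nat \<Rightarrow> (nat \<times> nat) list" where
  "row_positions n i = map (Pair i) (rev [1..<n + 1 - i])"

definition positions :: "nat \<Rightarrow> (nat \<times> nat) list" where
  "positions n = concat (map (row_positions n) [1..<n])"

definition weight :: "(nat \<Rightarrow> 'a::comm_ring_1) \<Rightarrow> (nat \<Rightarrow> 'a) \<Rightarrow> nat \<times> nat \<Rightarrow> 'a" where
  "weight x y = (\<lambda>(i, j). x i \<oplus> y j)"

lemma expect_row_positions:
  assumes "1 \<le> i"
  shows "expect (weight x y) (row_positions n i) \<phi> = row_op (x i) i (map y [1..<n + 1 - i]) \<phi>"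
proof -
  have "expect (weight x y) (map (Pair i) (rev [j..<j + k])) \<phi> = row_op (x i) (i + j - 1) (map y [j..<j + k]) \<phi>"
    if "1 \<le> j" for j k
    using that
  proof (induction k arbitrary: j \<phi>)
    case (Suc k)
    have "[j..<j + Suc k] = j # [Suc j..<Suc j + k]"
      by (simp add: upt_conv_Cons)
    then show ?case
      using Suc.IH[of "Suc j"] Suc.prems by (simp add: expect_append weight_def)
  qed simp
  from this[of 1 "n - i"] show ?thesis
    by (cases "i \<le> n") (simp_all add: row_positions_def Suc_diff_le)
qed

lemma positions_split:
  assumes "a \<in> {1..<n}"
  shows "positions n = concat (map (row_positions n) [1..<a]) @ row_positions n a
    @ row_positions n (a + 1) @ concat (map (row_positions n) [a + 2..<n + 1])"
proof -
  \<comment> \<open>Row \<open>n\<close> is empty; adding it covers the case \<open>a + 1 = n\<close>.\<close>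
  have "positions n = concat (map (row_positions n) [1..<n + 1])"
    using assms by (simp add: positions_def row_positions_def)
  also have "[1..<n + 1] = [1..<a] @ a # (a + 1) # [a + 2..<n + 1]"
  proof -
    have "[1..<n + 1] = [1..<a] @ [a..<n + 1]"
      using assms upt_add_eq_append[of 1 a "n + 1 - a"] by simp
    then show ?thesis
      using assms by (simp add: upt_conv_Cons)
  qed
  finally show ?thesis by simp
qed

text \<open>The rows above \<open>a\<close> do not involve the two variables exchanged. The rows below \<open>a + 1\<close>
do not either, and their letters exceed \<open>a + 1\<close>, so that the extra factor commutes with them and
reaches the two rows in question, where \<open>row_op_exchange\<close> applies.\<close>

lemma expect_exchange:
  fixes x y :: "nat \<Rightarrow> 'a::comm_ring_1"
  assumes a: "a \<in> {1..<n}"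
  shows "expect (weight x y) (positions n) (hecke_op a (1 - x (a + 1)) (x (a + 1) - x a) \<phi>) =
    (\<lambda>u. (1 - x a) * expect (weight (x \<circ> s_perm a) y) (positions n) \<phi> u)"
proof -
  define above where "above = concat (map (row_positions n) [1..<a])"
  define below where "below = concat (map (row_positions n) [a + 2..<n + 1])"
  let ?x' = "x \<circ> s_perm a"
  have above: "expect (weight ?x' y) above \<psi> = expect (weight x y) above \<psi>" for \<psi>
    by (rule expect_cong)
      (auto simp: above_def row_positions_def weight_def Transposition.transpose_def)
  have below: "expect (weight ?x' y) below \<psi> = expect (weight x y) below \<psi>" for \<psi>
    by (rule expect_cong)
      (auto simp: below_def row_positions_def weight_def Transposition.transpose_def)
  have commute: "expect (weight x y) below (hecke_op a k l \<psi>) = hecke_op a k l (expect (weight x y) below \<psi>)" for k l \<psi>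
    by (rule expect_hecke_op_commute) (auto simp: below_def row_positions_def)
  let ?ys = "map y [1..<n + 1 - a]"
  have ys: "?ys \<noteq> []" "map y [1..<n + 1 - (a + 1)] = butlast ?ys"
    using a by (auto simp: map_butlast[symmetric] Suc_diff_le)
  have x': "?x' a = x (a + 1)" "?x' (a + 1) = x a"
    by simp_all
  have "1 \<le> a" "1 \<le> a + 1" using a by auto
  note row = this[THEN expect_row_positions]
  show ?thesis
    unfolding positions_split[OF a] above_def[symmetric] below_def[symmetric]
      expect_append above below commute row ys(2) x' row_op_exchange[OF ys(1)] expect_scale ..
qed

lemma s_act_expect:
  assumes "\<And>u. s_act i (\<phi> u) = \<phi> u"
  shows "s_act i (expect c ps \<phi> u) = expect (\<lambda>p. s_act i (c p)) ps \<phi> u"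
  using assms
  by (induction ps arbitrary: u)
    (simp_all add: cross_op_def hecke_op_def s_act_add s_act_mult s_act_diff s_act_1)

definition point :: "(nat \<Rightarrow> nat) \<Rightarrow> (nat \<Rightarrow> nat) \<Rightarrow> 'a::comm_ring_1" where
  "point w u = of_bool (u = w)"

text \<open>A permutation \<open>w\<close> with a descent at \<open>a\<close> is the image of two permutations under
\<open>demazure a\<close>: itself and the shorter \<open>w \<circ> s_perm a\<close>.\<close>

lemma point_demazure:
  assumes "w (a + 1) < w a"
  shows "point w (demazure a u) = point w u + point (w \<circ> s_perm a) u"
proof -
  have "u \<circ> s_perm a = w \<longleftrightarrow> u = w \<circ> s_perm a"
    by (auto simp: o_assoc[symmetric])
  then show ?thesis
    using assms by (auto simp: point_def demazure_def)
qed

abbreviation xy_weight :: "nat \<times> nat \<Rightarrow> xypoly" where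
  "xy_weight \<equiv> weight xv yv"

definition subword_sum :: "nat \<Rightarrow> (nat \<Rightarrow> nat) \<Rightarrow> xypoly" where
  "subword_sum n w = expect xy_weight (positions n) (point w) id"

text \<open>Evaluating \<open>expect_exchange\<close> at \<open>\<phi> = point w\<close> expresses \<open>s_act a (subword_sum n w)\<close>
through \<open>subword_sum n w\<close> and \<open>subword_sum n (w \<circ> s_perm a)\<close>; the result is the equation
that defines \<open>pi_op a (subword_sum n w)\<close> as the sum of the two.\<close>

lemma mu_subword_sum:
  assumes a: "a \<in> {1..<n}" and desc: "w (a + 1) < w a"
  shows "mu a (subword_sum n w) = subword_sum n (w \<circ> s_perm a)"
proof (rule mu_eqI)
  let ?f = "subword_sum n w" and ?g = "subword_sum n (w \<circ> s_perm a)"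
  have swap: "s_act a ?f = expect (weight (xv \<circ> s_perm a) yv) (positions n) (point w) id"
  proof -
    have "(\<lambda>p. s_act a (xy_weight p)) = weight (xv \<circ> s_perm a) yv"
      by (auto simp: weight_def s_act_add s_act_mult s_act_diff s_act_xv s_act_yv)
    moreover have "s_act a (point w u) = point w u" for u
      by (simp add: point_def s_act_0 s_act_1)
    ultimately show ?thesis
      by (simp add: subword_sum_def s_act_expect)
  qed
  \<comment> \<open>The coefficient of \<open>xv (a + 1) - xv a\<close> comes from \<open>point_demazure\<close>.\<close>
  have exch: "(1 - xv (a + 1)) * ?f + (xv (a + 1) - xv a) * (?f + ?g) = (1 - xv a) * s_act a ?f"
    using fun_cong[OF expect_exchange[OF a, of xv yv "point w"], of id]
    unfolding swap unfolding expect_hecke_op point_demazure[OF desc, abs_def] expect_add subword_sum_def by simp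
  have act: "s_act a ((1 - xv (a + 1)) * ?f) = (1 - xv a) * s_act a ?f"
    by (simp add: s_act_mult s_act_diff s_act_1 s_act_xv)
  show "(xv a - xv (a + 1)) * (?f + ?g) = (1 - xv (a + 1)) * ?f - s_act a ((1 - xv (a + 1)) * ?f)"
    using exch unfolding act by (simp add: algebra_simps)
qed

section \<open>Grouping subwords by reduced subsets\<close>

text \<open>The reading word of a subset along an arbitrary list of positions, so that initial and final
segments of the reading order, and its reversal, can be treated alike.\<close>

definition word_of :: "(nat \<times> nat) list \<Rightarrow> (nat \<times> nat) set \<Rightarrow> nat list" where
  "word_of ps R = map letter (filter (\<lambda>p. p \<in> R) ps)"

lemma word_of_Nil [simp]: "word_of [] R = []"
  by (simp add: word_of_def)

lemma word_of_Cons [simp]: "word_of (p # ps) R = (if p \<in> R then letter p # word_of ps R else word_of ps R)"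
  by (simp add: word_of_def)

lemma word_of_append [simp]: "word_of (ps @ qs) R = word_of ps R @ word_of qs R"
  by (simp add: word_of_def)

lemma word_of_rev: "word_of (rev ps) R = rev (word_of ps R)"
  by (simp add: word_of_def rev_map rev_filter)

lemma word_of_insert: "p \<notin> set ps \<Longrightarrow> word_of ps (insert p R) = word_of ps R"
  by (induction ps) auto

text \<open>The positions outside \<open>R\<close> at which a crossing would be ignored, because the permutation reached
from \<open>u\<close> by the crossings of \<open>R\<close> before that position already has a descent there.\<close>

fun absorbed :: "(nat \<Rightarrow> nat) \<Rightarrow> (nat \<times> nat) list \<Rightarrow> (nat \<times> nat) set \<Rightarrow> (nat \<times> nat) set" where
  "absorbed u [] R = {}"
| "absorbed u (p # ps) R =
    (if p \<in> R then absorbed (u \<circ> s_perm (letter p)) ps R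
     else if u (letter p + 1) < u (letter p) then insert p (absorbed u ps R)
     else absorbed u ps R)"

lemma absorbed_insert: "p \<notin> set ps \<Longrightarrow> absorbed u ps (insert p R) = absorbed u ps R"
  by (induction ps arbitrary: u) auto

lemma absorbed_subset: "absorbed u ps R \<subseteq> set ps"
  by (induction ps arbitrary: u) auto

lemma mem_absorbed_iff:
  "p \<in> absorbed u ps R \<longleftrightarrow> p \<notin> R \<and> (\<exists>qs rs. ps = qs @ p # rs \<and>
     (u \<circ> word_perm (word_of qs R)) (letter p + 1) < (u \<circ> word_perm (word_of qs R)) (letter p))"
proof (induction ps arbitrary: u)
  case (Cons p' ps)
  have split: "(\<exists>qs rs. p' # ps = qs @ p # rs \<and> P qs) \<longleftrightarrow> (p' = p \<and> P []) \<or> (\<exists>qs rs. ps = qs @ p # rs \<and> P (p' # qs))" for P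
    by (auto simp: Cons_eq_append_conv)
  show ?case
    unfolding split using Cons.IH by (auto simp: o_def)
qed simp

definition rising_subsets :: "(nat \<Rightarrow> nat) \<Rightarrow> (nat \<times> nat) list \<Rightarrow> (nat \<Rightarrow> nat) \<Rightarrow> (nat \<times> nat) set set" where
  "rising_subsets u ps w =
    {R. R \<subseteq> set ps \<and> rising u (word_of ps R) \<and> u \<circ> word_perm (word_of ps R) = w}"

lemma rising_subsets_Cons:
  assumes "p \<notin> set ps"
  shows "rising_subsets u (p # ps) w = rising_subsets u ps w \<union>
    (if u (letter p) < u (letter p + 1)
     then insert p ` rising_subsets (u \<circ> s_perm (letter p)) ps w else {})" (is "?L = ?R")
proof (rule set_eqI)
  fix R
  show "R \<in> ?L \<longleftrightarrow> R \<in> ?R"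
  proof (cases "p \<in> R")
    case True
    then obtain R' where R: "R = insert p R'" "p \<notin> R'" by (meson mk_disjoint_insert)
    have "insert p R' = insert p R'' \<longleftrightarrow> R'' = R'" if "p \<notin> R''" for R''
      using R that by auto
    moreover have "p \<notin> R''" if "R'' \<in> rising_subsets u' ps w" for R'' u'
      using assms that by (auto simp: rising_subsets_def)
    ultimately have "insert p R' \<in> insert p ` rising_subsets u' ps w \<longleftrightarrow> R' \<in> rising_subsets u' ps w" for u'
      by (auto simp: image_iff)
    then show ?thesis
      using assms R by (auto simp: rising_subsets_def word_of_insert o_assoc)
  next
    case False
    then show ?thesis
      using assms by (auto simp: rising_subsets_def)
  qed
qed

text \<open>A position with an ascent splits the sum according to whether it carries a crossing. At a position
with a descent both choices lead to the same permutation, with total weight \<open>1\<close>; it stays outside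
\<open>R\<close> and becomes absorbed.\<close>

lemma expect_point:
  assumes "distinct ps" "inj u"
  shows "expect c ps (point w) u =
    (\<Sum>R\<in>rising_subsets u ps w. (\<Prod>p\<in>R. c p) * (\<Prod>p\<in>set ps - (R \<union> absorbed u ps R). 1 - c p))"
  using assms
proof (induction ps arbitrary: u)
  case Nil
  have "rising_subsets u [] w = (if u = w then {{}} else {})"
    by (auto simp: rising_subsets_def)
  then show ?case by (auto simp: point_def)
next
  case (Cons p ps)
  let ?a = "letter p"
  define summand where "summand u R = (\<Prod>p\<in>R. c p) * (\<Prod>p\<in>set ps - (R \<union> absorbed u ps R). 1 - c p)" for u R
  define summand' where "summand' R = (\<Prod>p\<in>R. c p) * (\<Prod>q\<in>set (p # ps) - (R \<union> absorbed u (p # ps) R). 1 - c q)" for R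
  have p: "p \<notin> set ps" and inj: "inj (u \<circ> s_perm ?a)"
    using Cons.prems by (auto intro: inj_compose)
  have sub: "R \<subseteq> set ps" if "R \<in> rising_subsets u' ps w" for R u'
    using that by (auto simp: rising_subsets_def)
  have fin: "finite (rising_subsets u' ps w)" for u'
    by (rule finite_subset[of _ "Pow (set ps)"]) (auto dest: sub)
  have IH: "expect c ps (point w) u' = sum (summand u') (rising_subsets u' ps w)" if "inj u'" for u'
    using Cons.IH that Cons.prems by (simp add: summand_def)
  have "u ?a \<noteq> u (?a + 1)"
    using Cons.prems by (simp add: inj_eq)
  then consider (asc) "u ?a < u (?a + 1)" | (desc) "u (?a + 1) < u ?a" by linarith
  then have "expect c (p # ps) (point w) u = sum summand' (rising_subsets u (p # ps) w)"
  proof cases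
    case asc
    have without: "summand' R = (1 - c p) * summand u R" if "R \<in> rising_subsets u ps w" for R
    proof -
      have "p \<notin> R" "p \<notin> absorbed u ps R"
        using p sub[OF that] absorbed_subset[of u ps R] by auto
      moreover from this have "set (p # ps) - (R \<union> absorbed u (p # ps) R) = insert p (set ps - (R \<union> absorbed u ps R))"
        using asc by auto
      ultimately show ?thesis
        using p by (simp add: summand_def summand'_def mult_ac)
    qed
    have "with": "summand' (insert p R) = c p * summand (u \<circ> s_perm ?a) R"
      if "R \<in> rising_subsets (u \<circ> s_perm ?a) ps w" for R
    proof -
      have "p \<notin> R" "p \<notin> absorbed (u \<circ> s_perm ?a) ps R" "finite R"
        using p sub[OF that] absorbed_subset[of "u \<circ> s_perm ?a" ps R] finite_subset[of R "set ps"] by auto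
      moreover from this have "set (p # ps) - (insert p R \<union> absorbed u (p # ps) (insert p R)) =
          set ps - (R \<union> absorbed (u \<circ> s_perm ?a) ps R)"
        using p by (auto simp: absorbed_insert)
      ultimately show ?thesis
        using p by (simp add: summand_def summand'_def mult_ac)
    qed
    have inj_insert: "inj_on (insert p) (rising_subsets (u \<circ> s_perm ?a) ps w)"
    proof (rule inj_onI)
      fix R R'
      assume "R \<in> rising_subsets (u \<circ> s_perm ?a) ps w" "R' \<in> rising_subsets (u \<circ> s_perm ?a) ps w"
        "insert p R = insert p R'"
      then show "R = R'"
        using sub p by (metis insert_ident subsetD)
    qed
    have disj: "rising_subsets u ps w \<inter> insert p ` rising_subsets (u \<circ> s_perm ?a) ps w = {}"
      using p sub by blast
    have "sum summand' (rising_subsets u (p # ps) w) =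
        sum summand' (rising_subsets u ps w) + sum summand' (insert p ` rising_subsets (u \<circ> s_perm ?a) ps w)"
      using asc fin disj by (simp add: rising_subsets_Cons[OF p] sum.union_disjoint)
    also have "\<dots> = (1 - c p) * expect c ps (point w) u + c p * expect c ps (point w) (u \<circ> s_perm ?a)"
      unfolding IH[OF inj] IH[OF Cons.prems(2)] sum.reindex[OF inj_insert] sum_distrib_left comp_def[of summand']
      by (intro arg_cong2[of _ _ _ _ "(+)"] sum.cong refl without "with")
    finally show ?thesis
      using asc by (simp add: cross_op_def hecke_op_def demazure_def)
  next
    case desc
    have "summand' R = summand u R" if "R \<in> rising_subsets u ps w" for R
    proof -
      have "p \<notin> R"
        using p sub[OF that] by auto
      then have "set (p # ps) - (R \<union> absorbed u (p # ps) R) = set ps - (R \<union> absorbed u ps R)"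
        using p desc by auto
      then show ?thesis
        by (simp add: summand_def summand'_def)
    qed
    then show ?thesis
      using desc Cons.prems
      by (simp add: rising_subsets_Cons[OF p] cross_op_def hecke_op_def demazure_def IH algebra_simps)
  qed
  then show ?case by (simp add: summand'_def)
qed

text \<open>The left action of the 0-Hecke monoid, which exchanges the values \<open>a\<close> and \<open>a + 1\<close> if this
lengthens the permutation.\<close>

definition demazure_left :: "nat \<Rightarrow> (nat \<Rightarrow> nat) \<Rightarrow> nat \<Rightarrow> nat" where
  "demazure_left a u = inv (demazure a (inv u))"

lemma bij_demazure: "bij u \<Longrightarrow> bij (demazure a u)"
  by (simp only: demazure_def bij_comp bij_transpose split: if_split) simp

lemma inv_comp_s_perm: "bij u \<Longrightarrow> inv (u \<circ> s_perm a) = s_perm a \<circ> inv u"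
  by (simp add: o_inv_distrib bij_imp_bij_inv inv_swap_id)

lemma demazure_left_conv: "bij u \<Longrightarrow> demazure_left a u = (if inv u a < inv u (a + 1) then s_perm a \<circ> u else u)"
  using inv_comp_s_perm[of "inv u" a] by (simp add: demazure_left_def demazure_def bij_imp_bij_inv inv_inv_eq)

lemma s_perm_less_iff:
  "{x, y} \<noteq> {a, a + 1} \<Longrightarrow> s_perm a x < s_perm a y \<longleftrightarrow> x < y"
  by (auto simp: Transposition.transpose_def)

text \<open>The left action alters the order of the entries at \<open>b\<close> and \<open>b + 1\<close> only if these entries are
\<open>a\<close> and \<open>a + 1\<close>, and symmetrically for the right action; in that case both actions apply the
same transposition.\<close>

lemma demazure_demazure_left_commute:
  assumes u: "bij u"
  shows "demazure b (demazure_left a u) = demazure_left a (demazure b u)"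
proof -
  define p q where "p = inv u a" and "q = inv u (a + 1)"
  have p: "u p = a" and q: "u q = a + 1"
    using u by (auto simp: p_def q_def bij_is_surj surj_f_inv_f)
  have eq: "u i = a \<longleftrightarrow> i = p" "u i = a + 1 \<longleftrightarrow> i = q" for i
    using inj_eq[OF bij_is_inj[OF u], of i] p q by metis+
  have left: "demazure_left a u = (if p < q then s_perm a \<circ> u else u)"
    by (simp add: demazure_left_conv u p_def q_def)
  have left': "demazure_left a (u \<circ> s_perm b) = (if s_perm b p < s_perm b q then s_perm a \<circ> u \<circ> s_perm b else u \<circ> s_perm b)"
    unfolding demazure_left_conv[OF bij_comp[OF bij_transpose u]] inv_comp_s_perm[OF u] p_def q_def
    by (simp add: o_assoc)
  show ?thesis
  proof (cases "p = b \<and> q = b + 1")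
    case True
    then have "u \<circ> s_perm b = s_perm a \<circ> u"
      using p q eq by (auto simp: fun_eq_iff Transposition.transpose_def)
    then show ?thesis
      using True p q left left' by (simp add: demazure_def)
  next
    case 1: False
    show ?thesis
    proof (cases "q = b \<and> p = b + 1")
      case True
      then show ?thesis
        using p q left by (simp add: demazure_def)
    next
      case 2: False
      have "s_perm b p < s_perm b q \<longleftrightarrow> p < q"
        using 1 2 by (intro s_perm_less_iff) (auto simp: doubleton_eq_iff)
      moreover have "s_perm a (u b) < s_perm a (u (b + 1)) \<longleftrightarrow> u b < u (b + 1)"
        using 1 2 eq[of b] eq[of "b + 1"] by (intro s_perm_less_iff) (auto simp: doubleton_eq_iff)
      ultimately show ?thesis
        using left left' by (cases "p < q"; cases "u b < u (b + 1)") (simp_all add: demazure_def o_assoc)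
    qed
  qed
qed

lemma expect_cong_bij:
  assumes "\<And>v. bij v \<Longrightarrow> \<phi> v = \<psi> v" "bij u"
  shows "expect c ps \<phi> u = expect c ps \<psi> u"
  using assms(2)
  by (induction ps arbitrary: u) (simp_all add: assms(1) cross_op_def hecke_op_def bij_demazure)

lemma expect_demazure_left:
  "bij u \<Longrightarrow> expect c ps \<phi> (demazure_left a u) = expect c ps (\<lambda>v. \<phi> (demazure_left a v)) u"
  by (induction ps arbitrary: u) (simp_all add: cross_op_def hecke_op_def bij_demazure demazure_demazure_left_commute)

text \<open>Reading the positions backwards inverts the Demazure product. As the left and right actions commute,
the first letter can be applied last, from the left; inversion turns this into a right action.\<close>

lemma expect_rev: "expect c (rev ps) (\<lambda>v. \<phi> (inv v)) id = expect c ps \<phi> id"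
proof (induction ps arbitrary: \<phi>)
  case (Cons p ps)
  let ?a = "letter p"
  have "demazure ?a id = demazure_left ?a id"
    by (simp add: demazure_left_def demazure_def inv_swap_id)
  then have "expect c (p # ps) \<phi> id = (1 - c p) * expect c ps \<phi> id + c p * expect c ps (\<lambda>v. \<phi> (demazure_left ?a v)) id"
    by (simp add: cross_op_def hecke_op_def expect_demazure_left[OF bij_id, symmetric])
  also have "\<dots> = (1 - c p) * expect c (rev ps) (\<lambda>v. \<phi> (inv v)) id +
      c p * expect c (rev ps) (\<lambda>v. \<phi> (demazure_left ?a (inv v))) id"
    by (simp only: Cons.IH[of \<phi>] Cons.IH[of "\<lambda>v. \<phi> (demazure_left ?a v)"])
  also have "expect c (rev ps) (\<lambda>v. \<phi> (demazure_left ?a (inv v))) id = expect c (rev ps) (\<lambda>v. \<phi> (inv (demazure ?a v))) id"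
    by (rule expect_cong_bij) (simp_all add: demazure_left_def inv_inv_eq)
  finally show ?case
    unfolding rev.simps expect_append expect.simps cross_op_def expect_hecke_op by (rule sym)
qed (simp add: fun_eq_iff)

section \<open>The longest permutation and the H-polynomials\<close>

lemma omega0_permutes: "omega0 n permutes {1..n}"
proof (rule bij_imp_permutes)
  show "bij_betw (omega0 n) {1..n} {1..n}"
    by (rule bij_betw_byWitness[of _ "omega0 n"]) (auto simp: omega0_def)
qed (auto simp: omega0_def)

lemma omega0_omega0: "omega0 n \<circ> omega0 n = id"
  by (auto simp: omega0_def fun_eq_iff)

lemma inv_omega0: "inv (omega0 n) = omega0 n"
  by (rule inv_unique_comp) (rule omega0_omega0)+

lemma omega0_less_iff:
  "i \<in> {1..n} \<Longrightarrow> j \<in> {1..n} \<Longrightarrow> omega0 n i < omega0 n j \<longleftrightarrow> j < i"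
  by (auto simp: omega0_def)

lemma set_positions: "set (positions n) = staircase n"
  by (force simp: positions_def row_positions_def staircase_def)

lemma distinct_positions: "distinct (positions n)"
proof -
  have first: "(x, 1) \<in> set (row_positions n y) \<longleftrightarrow> x = y" if "y \<in> {1..<n}" for x y
    using that by (auto simp: row_positions_def)
  have "inj_on (row_positions n) {1..<n}"
    by (rule inj_onI) (metis first)
  then have "distinct (map (row_positions n) [1..<n])"
    by (simp add: distinct_map)
  then show ?thesis
    unfolding positions_def
    by (rule distinct_concat) (auto simp: row_positions_def distinct_map inj_on_def)
qed

lemma letters_positions: "set (word_of (positions n) R) \<subseteq> {1..<n}"
  by (auto simp: word_of_def set_positions staircase_def)

lemma reading_word_positions:
  assumes "R \<subseteq> staircase n"
  shows "reading_word n R = word_of (positions n) R"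
proof -
  have row: "concat (map (\<lambda>j. if (i, j) \<in> R then [i + j - 1] else []) (rev [1..<n])) =
      word_of (row_positions n i) R" if "i \<in> {1..<n}" for i
  proof -
    have "concat (map (\<lambda>j. if (i, j) \<in> R then [i + j - 1] else []) js) = word_of (map (Pair i) js) R" for js
      by (induction js) auto
    moreover have "[1..<n] = [1..<n + 1 - i] @ [n + 1 - i..<n]"
      using that upt_add_eq_append[of 1 "n + 1 - i" "i - 1"] by (simp add: Suc_le_eq)
    moreover have "word_of (map (Pair i) (rev [n + 1 - i..<n])) R = []"
      using assms by (auto simp: word_of_def filter_empty_conv staircase_def)
    ultimately show ?thesis
      by (simp add: row_positions_def)
  qed
  have concat: "word_of (concat pss) R = concat (map (\<lambda>ps. word_of ps R) pss)" for pss
    by (induction pss) auto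
  have "map (\<lambda>i. concat (map (\<lambda>j. if (i, j) \<in> R then [i + j - 1] else []) (rev [1..<n]))) [1..<n] =
      map (\<lambda>i. word_of (row_positions n i) R) [1..<n]"
    by (intro map_cong refl row) auto
  then show ?thesis
    unfolding reading_word_def positions_def concat map_map comp_def by (rule arg_cong)
qed

lemma rc_graphs_eq_rising_subsets:
  assumes "w permutes {1..n}"
  shows "rc_graphs n w = rising_subsets id (positions n) w"
  using letters_positions[of n]
  by (auto simp: subset_eq rc_graphs_def rising_subsets_def reading_word_positions
      reduced_word_iff_rising[OF assms] set_positions)

text \<open>This is the contribution of one full row: a cycle that moves \<open>i\<close> to the end of the interval and
shifts the rest down.\<close>

lemma word_perm_decreasing_run:
  "word_perm (rev [i..<i + m]) k = (if k = i then i + m else if i < k \<and> k \<le> i + m then k - 1 else k)"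
  by (induction m arbitrary: k) (auto simp: Transposition.transpose_def)

text \<open>The first \<open>m\<close> rows place the \<open>m\<close> largest values in decreasing order at the first \<open>m\<close>
places and keep the remaining values increasing.\<close>

lemma word_perm_staircase: "word_perm (word_of (positions n) (staircase n)) = omega0 n"
proof -
  have "word_of (positions n) (staircase n) = map letter (positions n)"
    by (simp add: word_of_def filter_id_conv[THEN iffD2] set_positions)
  also have "\<dots> = concat (map (\<lambda>i. rev [i..<n]) [1..<n])"
  proof -
    have "map letter (row_positions n i) = rev [i..<n]" if "i \<in> {1..<n}" for i
    proof -
      have "map (\<lambda>j. i + j - 1) [1..<n + 1 - i] = [i..<n]"
        using that by (intro nth_equalityI) auto
      then show ?thesis
        unfolding row_positions_def map_map rev_map[symmetric] comp_def letter.simps by simp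
    qed
    then show ?thesis
      unfolding positions_def map_concat map_map
      by (intro arg_cong[of _ _ concat] map_cong refl) auto
  qed
  finally have word: "word_of (positions n) (staircase n) = concat (map (\<lambda>i. rev [i..<n]) [1..<n])" .
  have "word_perm (concat (map (\<lambda>i. rev [i..<n]) [1..<m + 1])) k =
      (if k \<in> {1..m} then n + 1 - k else if k \<in> {m + 1..n} then k - m else k)"
    if "m \<le> n - 1" for m k
    using that
  proof (induction m arbitrary: k)
    case 0
    then show ?case by simp
  next
    case (Suc m)
    have step: "word_perm (concat (map (\<lambda>i. rev [i..<n]) [1..<Suc m + 1])) k =
        word_perm (concat (map (\<lambda>i. rev [i..<n]) [1..<m + 1])) (word_perm (rev [Suc m..<n]) k)"
      by simp
    have run: "word_perm (rev [Suc m..<n]) k =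
        (if k = Suc m then n else if Suc m < k \<and> k \<le> n then k - 1 else k)"
      using word_perm_decreasing_run[of "Suc m" "n - Suc m" k] Suc.prems by simp
    have le: "m \<le> n - 1" using Suc.prems by simp
    show ?case
      unfolding step Suc.IH[OF le] run using Suc.prems by auto
  qed
  from this[of "n - 1"] show ?thesis
    unfolding word by (cases "n = 0") (auto simp: fun_eq_iff omega0_def)
qed

lemma card_inversions_omega0: "card (inversions n (omega0 n)) = card (staircase n)"
proof -
  have "bij_betw (\<lambda>(i, j). (i, i + j)) (staircase n) (inversions n (omega0 n))"
    by (rule bij_betw_byWitness[of _ "\<lambda>(i, j). (i, j - i)"])
      (auto simp: staircase_def inversions_def omega0_def)
  then show ?thesis
    by (metis bij_betw_same_card)
qed

lemma length_word_of:
  assumes "distinct ps" "R \<subseteq> set ps"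
  shows "length (word_of ps R) = card R"
proof -
  have "R = set (filter (\<lambda>p. p \<in> R) ps)"
    using assms(2) by auto
  then show ?thesis
    using distinct_card[of "filter (\<lambda>p. p \<in> R) ps"] assms(1) by (simp add: word_of_def)
qed

text \<open>The longest permutation has as many inversions as the staircase has positions, so only the full
staircase provides enough letters.\<close>

lemma rising_subsets_omega0: "rising_subsets id (positions n) (omega0 n) = {staircase n}"
proof -
  have len: "length (word_of (positions n) R) = card R" if "R \<subseteq> staircase n" for R
    using length_word_of[OF distinct_positions] that by (simp add: set_positions)
  have card: "card (inversions n (word_perm (word_of (positions n) R))) = length (word_of (positions n) R)
      \<longleftrightarrow> rising id (word_of (positions n) R)" for R
    using card_inversions_word[OF inj_on_id letters_positions] by (simp add: inversions_id)
  have fin: "finite (staircase n)"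
    by (metis List.finite_set set_positions)
  have "R = staircase n" if "R \<in> rising_subsets id (positions n) (omega0 n)" for R
  proof (rule card_subset_eq[OF fin])
    show sub: "R \<subseteq> staircase n"
      using that by (auto simp: rising_subsets_def set_positions)
    have "card (inversions n (omega0 n)) = length (word_of (positions n) R)"
      using that card[of R] by (auto simp: rising_subsets_def)
    then show "card R = card (staircase n)"
      by (simp add: len[OF sub] card_inversions_omega0)
  qed
  moreover have "staircase n \<in> rising_subsets id (positions n) (omega0 n)"
  proof -
    have "rising id (word_of (positions n) (staircase n))"
      using card[of "staircase n"]
      unfolding word_perm_staircase len[OF subset_refl] card_inversions_omega0 by blast
    then show ?thesis
      unfolding rising_subsets_def set_positions by (simp add: word_perm_staircase)
  qed
  ultimately show ?thesis by blast
qed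

lemma subword_sum_omega0: "subword_sum n (omega0 n) = H_omega0 n"
proof -
  have "absorbed id (positions n) (staircase n) \<union> staircase n = staircase n"
    using absorbed_subset[of id "positions n" "staircase n"] by (auto simp: set_positions)
  then have empty: "staircase n - (staircase n \<union> absorbed id (positions n) (staircase n)) = {}"
    by blast
  then show ?thesis
    unfolding subword_sum_def H_omega0_def expect_point[OF distinct_positions inj_on_id] rising_subsets_omega0
      set_positions
    by (simp add: empty weight_def del: Diff_eq_empty_iff)
qed

text \<open>The word \<open>bs\<close> spells \<open>omega0 n \<circ> w\<close>, the inverse of the permutation by which the
H-polynomial of \<open>w\<close> is indexed. In this form removing its last letter passes to the longer
permutation \<open>w \<circ> s_perm b\<close>, and composition with \<open>omega0 n\<close> turns the ascents recorded by
\<open>rising\<close> into the descents needed for \<open>mu_subword_sum\<close>.\<close>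

lemma foldr_mu_subword_sum:
  assumes "set bs \<subseteq> {1..<n}" "rising id bs" "word_perm bs = omega0 n \<circ> w" "w permutes {1..n}"
  shows "foldr mu (rev bs) (H_omega0 n) = subword_sum n w"
  using assms
proof (induction bs arbitrary: w rule: rev_induct)
  case Nil
  then have "w = omega0 n \<circ> (omega0 n \<circ> w)"
    by (simp add: o_assoc omega0_omega0)
  also have "omega0 n \<circ> w = id"
    using Nil(3) unfolding word_perm_Nil by (rule sym)
  finally have "w = omega0 n"
    unfolding comp_id .
  then show ?case
    by (simp add: subword_sum_omega0)
next
  case (snoc b bs)
  let ?w' = "w \<circ> s_perm b"
  have b: "b \<in> {1..<n}" and perm: "?w' permutes {1..n}"
    using snoc.prems by (auto intro!: permutes_compose permutes_swap_id)
  have "word_perm bs = word_perm (bs @ [b]) \<circ> s_perm b"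
    by (auto simp: fun_eq_iff)
  also have "\<dots> = omega0 n \<circ> ?w'"
    unfolding snoc.prems(3) by (simp add: o_assoc)
  finally have word: "word_perm bs = omega0 n \<circ> ?w'" .
  have "omega0 n (?w' b) < omega0 n (?w' (b + 1))"
    using snoc.prems(2) word by (simp add: rising_append)
  then have "?w' (b + 1) < ?w' b"
    using b permutes_in_image[OF perm] omega0_less_iff[of "?w' b" n "?w' (b + 1)"] by fastforce
  then have "mu b (subword_sum n ?w') = subword_sum n (?w' \<circ> s_perm b)"
    by (rule mu_subword_sum[OF b])
  moreover have "?w' \<circ> s_perm b = w"
    by (auto simp: fun_eq_iff)
  moreover have "foldr mu (rev bs) (H_omega0 n) = subword_sum n ?w'"
    using snoc.prems(1,2) by (intro snoc.IH[OF _ _ word perm]) (simp_all add: rising_append)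
  ultimately show ?case by simp
qed

lemma H_poly_eq_subword_sum:
  assumes w: "w permutes {1..n}"
  shows "H_poly n w = subword_sum n w"
proof -
  let ?v = "inv w \<circ> omega0 n"
  have v: "?v permutes {1..n}"
    by (intro permutes_compose omega0_permutes permutes_inv w)
  have "inv ?v = inv (omega0 n) \<circ> inv (inv w)"
    using w omega0_permutes by (intro o_inv_distrib permutes_bij permutes_inv)
  then have inv_v: "inv ?v = omega0 n \<circ> w"
    using w by (simp add: inv_omega0 permutes_inv_inv)
  have mu_word: "mu_word as (H_omega0 n) = subword_sum n w" if "reduced_word n ?v as" for as
  proof -
    have "reduced_word n (inv ?v) (rev as)"
      using that by (rule reduced_word_rev)
    then have "set (rev as) \<subseteq> {1..<n}" "rising id (rev as)" "word_perm (rev as) = omega0 n \<circ> w"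
      using reduced_word_iff_rising[OF permutes_inv[OF v]] inv_v by auto
    from foldr_mu_subword_sum[OF this w] show ?thesis
      by (simp add: mu_word_def)
  qed
  obtain as where "reduced_word n ?v as"
    using exists_rising_word[OF v] reduced_word_iff_rising[OF v] by blast
  then show ?thesis
    unfolding H_poly_def mu_perm_def
    using mu_word by (intro the_equality) auto
qed

section \<open>Lines and partial reading words\<close>

text \<open>Letters are applied from the right end of the word. Two entries can change their relative order only
when they are neighbours and the letter exchanges them.\<close>

lemma flip_crossing:
  assumes "x < y" "word_perm as y < word_perm as x"
  shows "\<exists>bs c cs. as = bs @ c # cs \<and> word_perm cs x = c \<and> word_perm cs y = c + 1"
  using assms
proof (induction as)
  case (Cons a as)
  show ?case
  proof (cases "word_perm as y < word_perm as x")
    case True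
    then obtain bs c cs where "as = bs @ c # cs" "word_perm cs x = c" "word_perm cs y = c + 1"
      using Cons by blast
    then show ?thesis
      by (intro exI[of _ "a # bs"] exI[of _ c] exI[of _ cs]) simp
  next
    case False
    moreover have "word_perm as x \<noteq> word_perm as y"
      using Cons.prems by (auto dest: injD[OF bij_is_inj[OF bij_word_perm]])
    ultimately have "word_perm as x = a \<and> word_perm as y = a + 1"
      using Cons.prems(2) by (auto simp: Transposition.transpose_def split: if_splits)
    then show ?thesis
      by (intro exI[of _ "[]"] exI[of _ a] exI[of _ as]) simp
  qed
qed simp

text \<open>In a reduced word the letters in front of \<open>c\<close> reach a permutation with an ascent at \<open>c\<close>, so two
lines exchanged by \<open>c\<close> end up in the exchanged order.\<close>

lemma rising_crossing:
  assumes "rising id (bs @ c # cs)" "word_perm cs x = c" "word_perm cs y = c + 1"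
  shows "word_perm (bs @ c # cs) y < word_perm (bs @ c # cs) x"
  using assms by (simp add: rising_append)

text \<open>In a reduced word two lines cross at most once: by \<open>rising_crossing\<close>, two crossings in opposite
directions would require opposite final orders.\<close>

lemma rising_inverted:
  assumes rising: "rising id (as @ bs @ cs)" and "x < y" and inv: "word_perm cs y < word_perm cs x"
  shows "word_perm (bs @ cs) y < word_perm (bs @ cs) x"
proof (rule ccontr)
  have final: "word_perm (as @ bs @ cs) y < word_perm (as @ bs @ cs) x"
  proof -
    obtain ds e es where cs: "cs = ds @ e # es" and e: "word_perm es x = e" "word_perm es y = e + 1"
      using flip_crossing[OF \<open>x < y\<close> inv] by blast
    have "as @ bs @ cs = (as @ bs @ ds) @ e # es" by (simp add: cs)
    then show ?thesis
      using rising_crossing[of "as @ bs @ ds" e es x y] rising e by metis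
  qed
  assume "\<not> ?thesis"
  moreover have "word_perm (bs @ cs) x \<noteq> word_perm (bs @ cs) y"
    using \<open>x < y\<close> inj_eq[OF bij_is_inj[OF bij_word_perm]] by (metis less_irrefl)
  ultimately have "word_perm bs (word_perm cs x) < word_perm bs (word_perm cs y)"
    by simp
  then obtain ds e es where bs: "bs = ds @ e # es"
    and e: "word_perm es (word_perm cs y) = e" "word_perm es (word_perm cs x) = e + 1"
    using flip_crossing[OF inv] by blast
  have "as @ bs @ cs = (as @ ds) @ e # (es @ cs)" by (simp add: bs)
  then have "word_perm (as @ bs @ cs) x < word_perm (as @ bs @ cs) y"
    using rising_crossing[of "as @ ds" e "es @ cs" y x] rising e by (metis comp_apply word_perm_append)
  then show False
    using final by simp
qed

definition later :: "nat \<times> nat \<Rightarrow> (nat \<times> nat) set" where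
  "later = (\<lambda>(i, j). {(i', j'). i < i' \<or> i = i' \<and> j' < j})"

lemma later_iff [simp]: "(i', j') \<in> later (i, j) \<longleftrightarrow> i < i' \<or> i = i' \<and> j' < j"
  by (simp add: later_def)

lemma later_asym: "q \<in> later p \<Longrightarrow> p \<notin> later q"
  by (cases p; cases q) auto

lemma sorted_positions: "sorted_wrt (\<lambda>p q. q \<in> later p) (positions n)"
proof -
  have row: "sorted_wrt (\<lambda>p q. q \<in> later p) (row_positions n i)" for i
    unfolding row_positions_def sorted_wrt_map sorted_wrt_rev
    using sorted_wrt_upt by (rule sorted_wrt_mono_rel[rotated]) simp
  have "sorted_wrt (\<lambda>p q. q \<in> later p) (concat (map (row_positions n) is))"
    if "sorted_wrt (<) is" for "is"
    using that
  proof (induction "is")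
    case (Cons i "is")
    have "q \<in> later p" if "p \<in> set (row_positions n i)" "q \<in> set (concat (map (row_positions n) is))" for p q
      using that Cons.prems by (auto simp: row_positions_def)
    then show ?case
      using Cons row by (simp add: sorted_wrt_append)
  qed simp
  then show ?thesis
    unfolding positions_def using sorted_wrt_upt by blast
qed

lemma word_of_union:
  assumes "sorted_wrt (\<lambda>p q. q \<in> later p) ps" "\<And>p q. p \<in> P \<Longrightarrow> q \<in> Q \<Longrightarrow> q \<in> later p"
  shows "word_of ps (P \<union> Q) = word_of ps P @ word_of ps Q"
  using assms(1)
proof (induction ps)
  case (Cons r ps)
  have disj: "q \<notin> P" if "r \<in> Q" "q \<in> set ps" for q
    using that Cons.prems assms(2)[of q r] later_asym[of q r] by auto
  have Nil: "word_of ps P = []" if "r \<in> Q"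
    using disj[OF that] by (auto simp: word_of_def filter_empty_conv)
  have "r \<notin> P" if "r \<in> Q"
    using that assms(2)[of r r] later_asym[of r r] by blast
  then show ?case
    using Cons Nil by auto
qed simp

text \<open>Cut the drawing along the boundary of the region read after \<open>p\<close>, and number the places at which
lines pass the cut from the upper left to the lower right. Letters act from the right, so those read
after \<open>p\<close> are the ones that a line meets before it reaches the cut, and \<open>tail_perm n R p k\<close> is
the place of line \<open>k\<close>.\<close>

definition tail_perm :: "nat \<Rightarrow> (nat \<times> nat) set \<Rightarrow> nat \<times> nat \<Rightarrow> nat \<Rightarrow> nat" where
  "tail_perm n R p = word_perm (word_of (positions n) (R \<inter> later p))"

lemma bij_tail_perm: "bij (tail_perm n R p)"
  unfolding tail_perm_def by (rule bij_word_perm)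

lemma tail_perm_eq:
  assumes "positions n = qs @ p # rs"
  shows "tail_perm n R p = word_perm (word_of rs R)"
proof -
  have "q \<notin> later p" if "q \<in> set qs \<or> q = p" for q
    using that sorted_positions[of n] later_asym[of p q] unfolding assms
    by (auto simp: sorted_wrt_append)
  moreover have "q \<in> later p" if "q \<in> set rs" for q
    using that sorted_positions[of n] unfolding assms by (auto simp: sorted_wrt_append)
  ultimately have "filter (\<lambda>q. q \<in> R \<inter> later p) qs = []"
    "filter (\<lambda>q. q \<in> R \<inter> later p) rs = filter (\<lambda>q. q \<in> R) rs" "p \<notin> later p"
    by (auto simp: filter_empty_conv intro!: filter_cong)
  then show ?thesis
    by (simp add: tail_perm_def assms word_of_def)
qed

lemma positions_around:
  assumes "p \<in> staircase n"
  obtains qs rs where "positions n = qs @ p # rs"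
    "\<And>q. q \<in> staircase n \<Longrightarrow> q \<in> later p \<Longrightarrow> q \<in> set rs"
    "\<And>q. q \<in> set rs \<Longrightarrow> q \<in> later p" "\<And>q. q \<in> set qs \<Longrightarrow> p \<in> later q"
proof -
  obtain qs rs where split: "positions n = qs @ p # rs"
    using assms split_list set_positions by metis
  have sorted: "\<forall>q\<in>set rs. q \<in> later p" "\<forall>q\<in>set qs. p \<in> later q"
    using sorted_positions[of n] unfolding split by (auto simp: sorted_wrt_append)
  have "set qs \<union> {p} \<union> set rs = staircase n"
    using set_positions[of n] split by auto
  then show ?thesis
    using sorted later_asym by (intro that[OF split]) blast+
qed

lemma word_of_single: "p \<in> staircase n \<Longrightarrow> word_of (positions n) {p} = [letter p]"
proof -
  assume "p \<in> staircase n"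
  then obtain qs rs where ps: "positions n = qs @ p # rs"
    using split_list set_positions by metis
  then have "p \<notin> set qs" "p \<notin> set rs"
    using distinct_positions[of n] by auto
  then have "filter (\<lambda>q. q = p) qs = []" "filter (\<lambda>q. q = p) rs = []"
    by (auto simp: filter_empty_conv)
  then show ?thesis
    by (simp add: word_of_def ps)
qed

text \<open>Between \<open>(i, j)\<close> and its right neighbour the cut passes only the position \<open>(i, j)\<close> itself.\<close>

lemma tail_perm_right:
  assumes "R \<subseteq> staircase n" "1 \<le> j"
  shows "tail_perm n R (i, j + 1) =
    (if (i, j) \<in> R then s_perm (i + j - 1) \<circ> tail_perm n R (i, j) else tail_perm n R (i, j))"
proof -
  have "R \<inter> later (i, j + 1) = (R \<inter> {(i, j)}) \<union> (R \<inter> later (i, j))"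
    by auto
  then have "tail_perm n R (i, j + 1) =
      word_perm (word_of (positions n) (R \<inter> {(i, j)}) @ word_of (positions n) (R \<inter> later (i, j)))"
    unfolding tail_perm_def by (subst word_of_union[OF sorted_positions, symmetric]) auto
  moreover have "word_of (positions n) {} = []"
    by (simp add: word_of_def)
  moreover have "word_of (positions n) {(i, j)} = [i + j - 1]" if "(i, j) \<in> R"
    using that assms word_of_single[of "(i, j)" n] by auto
  ultimately show ?thesis
    by (simp add: tail_perm_def)
qed

text \<open>From the cut to the left of \<open>(i, j + 1)\<close> to the one below \<open>(i - 1, j)\<close>, the positions passed are
the rest of row \<open>i\<close> and the beginning of row \<open>i - 1\<close>; their letters are too large and too small,
respectively, to move the line at place \<open>i + j - 1\<close>.\<close>

lemma tail_perm_up: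
  assumes "R \<subseteq> staircase n" "1 < i" "1 \<le> j" "tail_perm n R (i, j + 1) k = i + j - 1"
  shows "tail_perm n R (i - 1, j) k = i + j - 1"
proof -
  let ?Z = "R \<inter> (later (i - 1, j) - later (i, j + 1))"
  have "R \<inter> later (i - 1, j) = ?Z \<union> (R \<inter> later (i, j + 1))"
    using assms(2) by auto
  moreover have "word_of (positions n) (?Z \<union> (R \<inter> later (i, j + 1))) =
      word_of (positions n) ?Z @ word_of (positions n) (R \<inter> later (i, j + 1))"
    using assms(2) by (intro word_of_union[OF sorted_positions]) auto
  ultimately have "tail_perm n R (i - 1, j) k = word_perm (word_of (positions n) ?Z) (i + j - 1)"
    using assms(4) by (simp add: tail_perm_def)
  also have "\<dots> = i + j - 1"
    using assms(1-3) by (intro word_perm_fixed) (auto simp: word_of_def staircase_def)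
  finally show ?thesis .
qed

text \<open>At \<open>(i, j)\<close> the line from the left is at place \<open>i + j - 1\<close> of the cut and the line from below
at place \<open>i + j\<close>. Each of the drawing rules preserves this.\<close>

lemma line_tail_perm:
  assumes "line n R k i j d" "R \<subseteq> staircase n"
  shows "k \<in> {1..n} \<and> 1 \<le> i \<and> 1 \<le> j \<and>
    (d = From_left \<longrightarrow> i + j \<le> n + 1 \<and> tail_perm n R (i, j) k = i + j - 1) \<and>
    (d = From_below \<longrightarrow> i + j \<le> n \<and> tail_perm n R (i, j) k = i + j)"
  using assms(1)
proof (induction rule: line.induct)
  case start
  have "tail_perm n R (k, 1) k = k"
    unfolding tail_perm_def using assms(2)
    by (intro word_perm_fixed) (auto simp: word_of_def staircase_def)
  then show ?case using start by auto
next
  case (cross_left i j)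
  then have "i + j \<le> n" using assms(2) by (auto simp: staircase_def)
  then show ?case
    using cross_left tail_perm_right[OF assms(2), of j i] by auto
next
  case (cross_below i j)
  then have "tail_perm n R (i, j + 1) k = i + j - 1"
    using tail_perm_right[OF assms(2), of j i] by (auto simp: Transposition.transpose_def)
  then show ?case
    using cross_below tail_perm_up[OF assms(2), of i j k] by auto
next
  case (avoid_left i j)
  then have "tail_perm n R (i, j + 1) k = i + j - 1"
    using tail_perm_right[OF assms(2), of j i] by auto
  then show ?case
    using avoid_left tail_perm_up[OF assms(2), of i j k] by auto
next
  case (avoid_below i j)
  then show ?case
    using tail_perm_right[OF assms(2), of j i] by auto
qed

text \<open>A line entering \<open>(i, j)\<close> comes from the left or lower neighbour, or starts in column 1. Just
outside the staircase, where \<open>i + j = n + 1\<close>, there is a line from the left but none from below.\<close>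

lemma line_exists:
  assumes "R \<subseteq> staircase n" "1 \<le> i" "1 \<le> j"
  shows "(i + j \<le> n + 1 \<longrightarrow> (\<exists>k. line n R k i j From_left)) \<and>
    (i + j \<le> n \<longrightarrow> (\<exists>k. line n R k i j From_below))"
  using assms(2,3)
proof (induction "n + j - i" arbitrary: i j rule: less_induct)
  case less
  have "\<exists>k. line n R k i j From_left" if le: "i + j \<le> n + 1"
  proof (cases "j = 1")
    case True
    then show ?thesis
      using le less.prems line.start[of i n R] by auto
  next
    case False
    then have "n + (j - 1) - i < n + j - i" "1 \<le> j - 1" "i + (j - 1) \<le> n"
      using le less.prems by auto
    then obtain k k' where "line n R k i (j - 1) From_left" "line n R k' i (j - 1) From_below"
      using less.hyps[of "j - 1" i] less.prems by auto
    then show ?thesis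
      using line.cross_left[of n R k i "j - 1"] line.avoid_below[of n R k' i "j - 1"] False less.prems
      by (cases "(i, j - 1) \<in> R") auto
  qed
  moreover have "\<exists>k. line n R k i j From_below" if le: "i + j \<le> n"
  proof -
    have smaller: "n + j - (i + 1) < n + j - i"
      using le less.prems by auto
    have left: "\<exists>k. line n R k (i + 1) j From_left"
      using less.hyps[OF smaller] le less.prems by auto
    have below: "\<exists>k. line n R k (i + 1) j From_below" if "(i + 1, j) \<in> R"
    proof -
      have "i + 1 + j \<le> n" using that assms(1) by (auto simp: staircase_def)
      then show ?thesis
        using less.hyps[OF smaller] less.prems by auto
    qed
    show ?thesis
      using left below line.cross_below[of n R _ "i + 1" j] line.avoid_left[of n R _ "i + 1" j] less.prems
      by (cases "(i + 1, j) \<in> R") fastforce+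
  qed
  ultimately show ?case by blast
qed

text \<open>\<open>line_tail_perm\<close> gives one direction. Conversely some line enters from each side, and it must be
the given one, because \<open>tail_perm\<close> is injective.\<close>

lemma line_iff:
  assumes "R \<subseteq> staircase n" "(i, j) \<in> staircase n"
  shows "line n R k i j From_left \<longleftrightarrow> tail_perm n R (i, j) k = i + j - 1"
    and "line n R k i j From_below \<longleftrightarrow> tail_perm n R (i, j) k = i + j"
proof -
  have ij: "1 \<le> i" "1 \<le> j" "i + j \<le> n" using assms(2) by (auto simp: staircase_def)
  obtain a b where ab: "line n R a i j From_left" "line n R b i j From_below"
    using line_exists[OF assms(1) ij(1,2)] ij by auto
  have inj: "tail_perm n R (i, j) x = tail_perm n R (i, j) y \<longleftrightarrow> x = y" for x y
    by (rule inj_eq[OF bij_is_inj[OF bij_tail_perm]])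
  show "line n R k i j From_left \<longleftrightarrow> tail_perm n R (i, j) k = i + j - 1"
    using line_tail_perm[OF _ assms(1)] ab(1) inj by metis
  show "line n R k i j From_below \<longleftrightarrow> tail_perm n R (i, j) k = i + j"
    using line_tail_perm[OF _ assms(1)] ab(2) inj by metis
qed

text \<open>Lines followed as the iterates of a total function, which makes any two points of the same line
comparable. Truncated subtraction in row 0 is harmless, as a line stops before reaching it.\<close>

fun advance :: "(nat \<times> nat) set \<Rightarrow> nat \<times> nat \<times> entry \<Rightarrow> nat \<times> nat \<times> entry" where
  "advance R (i, j, d) =
    (if (i, j) \<in> R \<longleftrightarrow> d = From_left then (i, j + 1, From_left) else (i - 1, j, From_below))"

lemma line_advance: "line n R k i j d \<Longrightarrow> \<exists>t. (advance R ^^ t) (k, 1, From_left) = (i, j, d)"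
proof (induction rule: line.induct)
  case start
  show ?case by (rule exI[of _ 0]) simp
next
  case (cross_left i j)
  then obtain t where "(advance R ^^ t) (k, 1, From_left) = (i, j, From_left)" by blast
  then show ?case using cross_left by (intro exI[of _ "Suc t"]) simp
next
  case (cross_below i j)
  then obtain t where "(advance R ^^ t) (k, 1, From_left) = (i, j, From_below)" by blast
  then show ?case using cross_below by (intro exI[of _ "Suc t"]) simp
next
  case (avoid_left i j)
  then obtain t where "(advance R ^^ t) (k, 1, From_left) = (i, j, From_left)" by blast
  then show ?case using avoid_left by (intro exI[of _ "Suc t"]) simp
next
  case (avoid_below i j)
  then obtain t where "(advance R ^^ t) (k, 1, From_left) = (i, j, From_below)" by blast
  then show ?case using avoid_below by (intro exI[of _ "Suc t"]) simp
qed

lemma advance_monotone: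
  "(advance R ^^ m) (i, j, d) = (i', j', d') \<Longrightarrow> i' \<le> i \<and> j \<le> j'"
proof (induction m arbitrary: i' j' d')
  case (Suc m)
  obtain i2 j2 d2 where m: "(advance R ^^ m) (i, j, d) = (i2, j2, d2)"
    by (cases "(advance R ^^ m) (i, j, d)")
  then have "advance R (i2, j2, d2) = (i', j', d')" using Suc.prems by simp
  then show ?case
    using Suc.IH[OF m] by (auto split: if_splits)
qed simp

text \<open>Both points are reached from the start of the line, so one is reached from the other; as lines only
move up and to the right, the point later in the reading order comes first on the line.\<close>

lemma line_later:
  assumes "line n R k i j d" "line n R k i' j' d'" "(i', j') \<in> later (i, j)"
  obtains m where "(advance R ^^ Suc m) (i', j', d') = (i, j, d)"
proof -
  obtain t t' where t: "(advance R ^^ t) (k, 1, From_left) = (i, j, d)"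
    "(advance R ^^ t') (k, 1, From_left) = (i', j', d')"
    using assms(1,2) line_advance by metis
  show ?thesis
  proof (cases "t' < t")
    case True
    then obtain m where "t = Suc m + t'" using less_imp_Suc_add[OF True] by (auto simp: add.commute)
    then show ?thesis
      using t by (intro that[of m]) (simp add: funpow_add)
  next
    case False
    then obtain m where "t' = m + t" using le_Suc_ex[of t t'] by (auto simp: add.commute)
    then have "(advance R ^^ m) (i, j, d) = (i', j', d')"
      using t by (simp add: funpow_add)
    then show ?thesis
      using advance_monotone assms(3) by fastforce
  qed
qed

text \<open>The last step of a line into \<open>(i, j)\<close> from the left changes the column, and from below the
row.\<close>

lemma line_later_southwest:
  assumes "line n R k i j d" "line n R k i' j' d'" "(i', j') \<in> later (i, j)" "1 \<le> i"
  shows "d = From_left \<Longrightarrow> j' < j" and "d = From_below \<Longrightarrow> i < i'"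
proof -
  obtain m where m: "(advance R ^^ Suc m) (i', j', d') = (i, j, d)"
    using line_later[OF assms(1-3)] .
  obtain i2 j2 d2 where m2: "(advance R ^^ m) (i', j', d') = (i2, j2, d2)"
    by (cases "(advance R ^^ m) (i', j', d')")
  then have "advance R (i2, j2, d2) = (i, j, d)" using m by simp
  moreover have "i2 \<le> i'" "j' \<le> j2"
    using advance_monotone[OF m2] by auto
  ultimately show "d = From_left \<Longrightarrow> j' < j" and "d = From_below \<Longrightarrow> i < i'"
    using assms(4) by (auto split: if_splits)
qed

text \<open>The first step of a line that avoids the other one at \<open>(i, j)\<close> goes up if it came from the left,
and to the right if it came from below.\<close>

lemma line_earlier_northeast:
  assumes "line n R k i j d" "line n R k i' j' d'" "(i, j) \<in> later (i', j')" "1 \<le> i" "(i, j) \<notin> R"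
  shows "d = From_left \<Longrightarrow> i' < i" and "d = From_below \<Longrightarrow> j < j'"
proof -
  obtain m where m: "(advance R ^^ Suc m) (i, j, d) = (i', j', d')"
    using line_later[OF assms(2,1,3)] .
  obtain i2 j2 d2 where m2: "advance R (i, j, d) = (i2, j2, d2)"
    by (cases "advance R (i, j, d)")
  then have "(advance R ^^ m) (i2, j2, d2) = (i', j', d')"
    using m by (simp add: funpow_swap1)
  then have "i' \<le> i2" "j2 \<le> j'"
    using advance_monotone by blast+
  then show "d = From_left \<Longrightarrow> i' < i" and "d = From_below \<Longrightarrow> j < j'"
    using assms(4,5) m2 by (auto split: if_splits)
qed

section \<open>Absorbable positions\<close>

lemma word_of_split:
  assumes "word_of ps R = bs @ c # cs"
  shows "\<exists>qs p rs. ps = qs @ p # rs \<and> p \<in> R \<and> letter p = c \<and> word_of rs R = cs"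
  using assms
proof (induction ps arbitrary: bs)
  case (Cons p ps)
  show ?case
  proof (cases "p \<in> R \<and> bs = []")
    case True
    then show ?thesis
      using Cons.prems by (intro exI[of _ "[]"] exI[of _ p] exI[of _ ps]) simp
  next
    case False
    then have "\<exists>bs'. word_of ps R = bs' @ c # cs"
      using Cons.prems by (auto simp: Cons_eq_append_conv split: if_splits)
    then obtain qs q rs where "ps = qs @ q # rs" "q \<in> R" "letter q = c" "word_of rs R = cs"
      using Cons.IH by blast
    then show ?thesis
      by (intro exI[of _ "p # qs"] exI[of _ q] exI[of _ rs]) simp
  qed
qed simp

context
  fixes n :: nat and R :: "(nat \<times> nat) set" and w :: "nat \<Rightarrow> nat"
  assumes sub: "R \<subseteq> staircase n"
    and rising: "rising id (word_of (positions n) R)"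
    and w: "word_perm (word_of (positions n) R) = w"
begin

text \<open>In a reduced set, the line that is horizontal at a crossing has the smaller label, and it ends to the
right of the other one.\<close>

lemma crossing_order:
  assumes "p \<in> R" "tail_perm n R p a = letter p" "tail_perm n R p b = letter p + 1"
  shows "a < b" and "w b < w a"
proof -
  obtain qs rs where split: "positions n = qs @ p # rs"
    using split_list[of p "positions n"] sub assms(1) by (auto simp: set_positions)
  have word: "word_of (positions n) R = word_of qs R @ letter p # word_of rs R"
    using assms(1) by (simp add: split)
  have word': "word_of (positions n) R = (word_of qs R @ [letter p]) @ word_of rs R"
    by (simp add: word)
  have at_p: "word_perm (word_of rs R) a = letter p" "word_perm (word_of rs R) b = letter p + 1"
    using assms(2,3) tail_perm_eq[OF split, of R] by simp_all
  show *: "w b < w a"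
    using rising_crossing[OF _ at_p, of "word_of qs R"] rising unfolding word[symmetric] w by blast
  show "a < b"
  proof (rule ccontr)
    assume "\<not> a < b"
    then have "b < a"
      using at_p by (cases "a = b") auto
    moreover have "word_perm (word_of rs R) a < word_perm (word_of rs R) b"
      using at_p by simp
    ultimately have "w a < w b"
      using rising_inverted[of "[]" "word_of qs R @ [letter p]" "word_of rs R" b a] rising
      unfolding append_Nil word'[symmetric] w by blast
    then show False
      using * by simp
  qed
qed

lemma tail_inverted:
  assumes "p \<in> staircase n" "p' \<in> staircase n" "p \<in> later p'"
    and "a < b" "tail_perm n R p b < tail_perm n R p a"
  shows "tail_perm n R p' b < tail_perm n R p' a"
proof -
  obtain qs rs where split: "positions n = qs @ p' # rs" and "p \<in> set rs"
    using positions_around[OF assms(2)] assms(1,3) by metis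
  then obtain rs1 rs2 where rs: "rs = rs1 @ p # rs2"
    using split_list by metis
  have tail: "tail_perm n R p = word_perm (word_of rs2 R)"
    by (rule tail_perm_eq[of n "qs @ p' # rs1"]) (simp add: split rs)
  have tail': "tail_perm n R p' = word_perm (word_of (rs1 @ [p]) R @ word_of rs2 R)"
    using tail_perm_eq[OF split, of R] by (simp add: rs)
  have "word_of (positions n) R = word_of (qs @ [p']) R @ word_of (rs1 @ [p]) R @ word_of rs2 R"
    by (simp add: split rs)
  then show ?thesis
    using rising_inverted[of "word_of (qs @ [p']) R" "word_of (rs1 @ [p]) R" "word_of rs2 R" a b]
      rising assms(4,5) unfolding tail tail' by simp
qed

lemma crossing_inverted:
  assumes "p \<in> staircase n" "p' \<in> R" "p' \<in> later p"
    and "tail_perm n R p' a = letter p'" "tail_perm n R p' b = letter p' + 1"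
  shows "tail_perm n R p b < tail_perm n R p a"
proof -
  obtain qs rs where split: "positions n = qs @ p # rs" and "p' \<in> set rs"
    using positions_around[OF assms(1)] assms(2,3) sub by (metis subsetD)
  then obtain rs1 rs2 where rs: "rs = rs1 @ p' # rs2"
    using split_list by metis
  have tail': "tail_perm n R p' = word_perm (word_of rs2 R)"
    by (rule tail_perm_eq[of n "qs @ p # rs1"]) (simp add: split rs)
  have tail: "tail_perm n R p = word_perm (word_of rs1 R @ letter p' # word_of rs2 R)"
    using tail_perm_eq[OF split, of R] assms(2) by (simp add: rs)
  have "word_of (positions n) R = word_of (qs @ [p]) R @ word_of rs1 R @ letter p' # word_of rs2 R"
    using assms(2) by (simp add: split rs)
  then show ?thesis
    using rising_inverted[of "word_of (qs @ [p]) R" "word_of rs1 R" "letter p' # word_of rs2 R" a b]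
      rising crossing_order(1)[OF assms(2,4,5)] assms(4,5) unfolding tail tail' by simp
qed

lemma meet_at_iff:
  assumes "(i, j) \<in> staircase n"
  shows "meet_at n R a b i j \<longleftrightarrow>
    tail_perm n R (i, j) a = i + j - 1 \<and> tail_perm n R (i, j) b = i + j \<or>
    tail_perm n R (i, j) b = i + j - 1 \<and> tail_perm n R (i, j) a = i + j"
  unfolding meet_at_def line_iff[OF sub assms] ..

text \<open>Line \<open>a\<close> enters from the left and line \<open>b\<close> from below, so \<open>a\<close> leaves \<open>(i, j)\<close> at the
smaller place. The two lines end in the opposite order exactly if they cross among the positions read
before \<open>(i, j)\<close>, and on both lines these positions lie to the northeast.\<close>

lemma mem_rabs_iff:
  assumes p: "(i, j) \<in> staircase n" "(i, j) \<notin> R"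
    and a: "tail_perm n R (i, j) a = i + j - 1" and b: "tail_perm n R (i, j) b = i + j"
  shows "(i, j) \<in> rabs n R \<longleftrightarrow> w b < w a"
proof -
  have ij: "1 \<le> i" "1 \<le> j" using p by (auto simp: staircase_def)
  have only: "tail_perm n R (i, j) x = i + j - 1 \<longleftrightarrow> x = a" "tail_perm n R (i, j) x = i + j \<longleftrightarrow> x = b" for x
    using a b inj_eq[OF bij_is_inj[OF bij_tail_perm]] by metis+
  show ?thesis
  proof
    assume "(i, j) \<in> rabs n R"
    then obtain x y i' j' where meet: "meet_at n R x y i j" "meet_at n R x y i' j'"
      and p': "(i', j') \<in> R" "i' < i" "j < j'"
      by (auto simp: rabs_def cross_at_def)
    have stair': "(i', j') \<in> staircase n" using p' sub by auto
    have xy: "{x, y} = {a, b}"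
      using meet(1) unfolding meet_at_iff[OF p(1)] only by auto
    obtain c d where cd: "{c, d} = {a, b}" "tail_perm n R (i', j') c = letter (i', j')"
      "tail_perm n R (i', j') d = letter (i', j') + 1"
    proof -
      have "i' + j' - 1 + 1 = i' + j'" using stair' by (auto simp: staircase_def)
      then show ?thesis
        using meet(2) that[of x y] that[of y x] xy unfolding meet_at_iff[OF stair'] by (auto simp: insert_commute)
    qed
    note final = crossing_order[OF p'(1) cd(2,3)]
    show "w b < w a"
    proof (cases "c = a")
      case True
      then show ?thesis
        using cd(1) final by (auto simp: doubleton_eq_iff)
    next
      case False
      then have "c = b" "d = a"
        using cd(1) by (auto simp: doubleton_eq_iff)
      then have "tail_perm n R (i', j') d < tail_perm n R (i', j') c"
        using tail_inverted[OF p(1) stair', of c d] final(1) p'(2) a b ij by auto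
      then show ?thesis
        using cd(2,3) by simp
    qed
  next
    assume less: "w b < w a"
    obtain qs rs where split: "positions n = qs @ (i, j) # rs"
      and qs: "\<And>q. q \<in> set qs \<Longrightarrow> (i, j) \<in> later q"
      using positions_around[OF p(1)] by metis
    note tail = tail_perm_eq[OF split, of R]
    have "w k = word_perm (word_of qs R) (tail_perm n R (i, j) k)" for k
      using p(2) by (simp add: w[symmetric] split tail)
    then have "word_perm (word_of qs R) (i + j) < word_perm (word_of qs R) (i + j - 1)"
      using less a b by simp
    then obtain bs c cs where flip: "word_of qs R = bs @ c # cs" "word_perm cs (i + j - 1) = c"
      "word_perm cs (i + j) = c + 1"
      using flip_crossing[of "i + j - 1" "i + j"] ij by fastforce
    obtain qs1 p' qs2 where p': "qs = qs1 @ p' # qs2" "p' \<in> R" "letter p' = c" "word_of qs2 R = cs"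
      using word_of_split[OF flip(1)] by blast
    obtain i' j' where p'_def: "p' = (i', j')" by (cases p')
    have stair': "(i', j') \<in> staircase n" using p'(2) sub p'_def by auto
    have "tail_perm n R (i', j') = word_perm (word_of (qs2 @ (i, j) # rs) R)"
      by (rule tail_perm_eq[of n qs1]) (simp add: split p' p'_def)
    then have "tail_perm n R (i', j') k = word_perm cs (tail_perm n R (i, j) k)" for k
      using p(2) p'(4) by (simp add: tail)
    then have "tail_perm n R (i', j') a = i' + j' - 1" "tail_perm n R (i', j') b = i' + j'"
      using a b flip(2,3) p'(3) stair' by (auto simp: p'_def staircase_def)
    then have lines': "line n R a i' j' From_left" "line n R b i' j' From_below"
      using line_iff[OF sub stair'] by auto
    have lines: "line n R a i j From_left" "line n R b i j From_below"
      using line_iff[OF sub p(1)] a b by auto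
    have later: "(i, j) \<in> later (i', j')"
      using qs[of p'] p'(1) p'_def by auto
    have "i' < i" "j < j'"
      using line_earlier_northeast[OF lines(1) lines'(1) later ij(1) p(2)]
        line_earlier_northeast[OF lines(2) lines'(2) later ij(1) p(2)] by auto
    moreover have "meet_at n R a b i j" "cross_at n R a b i' j'"
      using lines lines' p'(2) p'_def by (auto simp: meet_at_def cross_at_def)
    ultimately show "(i, j) \<in> rabs n R"
      using p unfolding rabs_def by blast
  qed
qed

text \<open>At \<open>(i, j)\<close> line \<open>a\<close> is at the smaller place, so \<open>b < a\<close> says that the two lines crossed on
their way to \<open>(i, j)\<close>, which for lines means to the southwest.\<close>

lemma mem_labs_iff:
  assumes p: "(i, j) \<in> staircase n" "(i, j) \<notin> R"
    and a: "tail_perm n R (i, j) a = i + j - 1" and b: "tail_perm n R (i, j) b = i + j"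
  shows "(i, j) \<in> labs n R \<longleftrightarrow> b < a"
proof -
  have ij: "1 \<le> i" "1 \<le> j" using p by (auto simp: staircase_def)
  have only: "tail_perm n R (i, j) x = i + j - 1 \<longleftrightarrow> x = a" "tail_perm n R (i, j) x = i + j \<longleftrightarrow> x = b" for x
    using a b inj_eq[OF bij_is_inj[OF bij_tail_perm]] by metis+
  show ?thesis
  proof
    assume "(i, j) \<in> labs n R"
    then obtain x y i' j' where meet: "meet_at n R x y i j" "meet_at n R x y i' j'"
      and p': "(i', j') \<in> R" "i < i'" "j' < j"
      by (auto simp: labs_def cross_at_def)
    have stair': "(i', j') \<in> staircase n" using p' sub by auto
    have xy: "{x, y} = {a, b}"
      using meet(1) unfolding meet_at_iff[OF p(1)] only by auto
    obtain c d where cd: "{c, d} = {a, b}" "tail_perm n R (i', j') c = letter (i', j')"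
      "tail_perm n R (i', j') d = letter (i', j') + 1"
    proof -
      have "i' + j' - 1 + 1 = i' + j'" using stair' by (auto simp: staircase_def)
      then show ?thesis
        using meet(2) that[of x y] that[of y x] xy unfolding meet_at_iff[OF stair'] by (auto simp: insert_commute)
    qed
    have "tail_perm n R (i, j) d < tail_perm n R (i, j) c"
      using crossing_inverted[OF p(1) p'(1) _ cd(2,3)] p'(2) by simp
    then have "c = b" "d = a"
      using cd(1) a b ij by (auto simp: doubleton_eq_iff)
    then show "b < a"
      using crossing_order(1)[OF p'(1) cd(2,3)] by simp
  next
    assume "b < a"
    obtain qs rs where split: "positions n = qs @ (i, j) # rs"
      and rs: "\<And>q. q \<in> set rs \<Longrightarrow> q \<in> later (i, j)"
      using positions_around[OF p(1)] by metis
    note tail = tail_perm_eq[OF split, of R]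
    have "word_perm (word_of rs R) a < word_perm (word_of rs R) b"
      using a b ij tail by simp
    then obtain bs c cs where flip: "word_of rs R = bs @ c # cs" "word_perm cs b = c"
      "word_perm cs a = c + 1"
      using flip_crossing[OF \<open>b < a\<close>] by blast
    obtain rs1 p' rs2 where p': "rs = rs1 @ p' # rs2" "p' \<in> R" "letter p' = c" "word_of rs2 R = cs"
      using word_of_split[OF flip(1)] by blast
    obtain i' j' where p'_def: "p' = (i', j')" by (cases p')
    have stair': "(i', j') \<in> staircase n" using p'(2) sub p'_def by auto
    have "tail_perm n R (i', j') = word_perm cs"
      using tail_perm_eq[of n "qs @ (i, j) # rs1" p' rs2 R] by (simp add: split p' p'_def)
    then have "tail_perm n R (i', j') b = i' + j' - 1" "tail_perm n R (i', j') a = i' + j'"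
      using flip(2,3) p'(3) stair' by (auto simp: p'_def staircase_def)
    then have lines': "line n R b i' j' From_left" "line n R a i' j' From_below"
      using line_iff[OF sub stair'] by auto
    have lines: "line n R a i j From_left" "line n R b i j From_below"
      using line_iff[OF sub p(1)] a b by auto
    have later: "(i', j') \<in> later (i, j)"
      using rs[of p'] p'(1) p'_def by auto
    have "i < i'" "j' < j"
      using line_later_southwest[OF lines(1) lines'(2) later ij(1)]
        line_later_southwest[OF lines(2) lines'(1) later ij(1)] by auto
    moreover have "meet_at n R a b i j" "cross_at n R a b i' j'"
      using lines lines' p'(2) p'_def by (auto simp: meet_at_def cross_at_def)
    ultimately show "(i, j) \<in> labs n R"
      using p unfolding labs_def by blast
  qed
qed

text \<open>A descent of the permutation read before \<open>p\<close> compares the ends of the two lines through \<open>p\<close>;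
in the reversed order, a descent of the inverse of \<open>tail_perm\<close> compares their labels.\<close>

lemma mem_absorbed_positions_iff:
  assumes p: "p \<in> staircase n" "p \<notin> R"
    and a: "tail_perm n R p a = letter p" and b: "tail_perm n R p b = letter p + 1"
  shows "p \<in> absorbed id (positions n) R \<longleftrightarrow> w b < w a"
    and "p \<in> absorbed id (rev (positions n)) R \<longleftrightarrow> b < a"
proof -
  have prefix: "word_perm (word_of qs R) (tail_perm n R p k) = w k" if "positions n = qs @ p # rs" for qs rs k
    using p(2) tail_perm_eq[OF that, of R] by (simp add: w[symmetric] that)
  obtain qs rs where "positions n = qs @ p # rs"
    using positions_around[OF p(1)] by metis
  moreover have "word_perm (word_of qs R) (letter p) = w a \<and> word_perm (word_of qs R) (letter p + 1) = w b"
    if "positions n = qs @ p # rs" for qs rs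
    using prefix[OF that, of a] prefix[OF that, of b] a b by simp
  ultimately show "p \<in> absorbed id (positions n) R \<longleftrightarrow> w b < w a"
    unfolding mem_absorbed_iff id_comp using p(2) by metis
  have inv: "inv (tail_perm n R p) (letter p) = a" "inv (tail_perm n R p) (letter p + 1) = b"
    using a b bij_is_inj[OF bij_tail_perm] by (metis inv_f_f)+
  have suffix: "word_perm (word_of qs' R) = inv (tail_perm n R p)" if "rev (positions n) = qs' @ p # rs'" for qs' rs'
  proof -
    have "positions n = rev rs' @ p # rev qs'"
      using that by (simp add: rev_swap)
    then show ?thesis
      using tail_perm_eq[of n "rev rs'" p "rev qs'" R] by (simp add: inv_word_perm word_of_rev)
  qed
  have "rev (positions n) = rev rs @ p # rev qs"
    using \<open>positions n = qs @ p # rs\<close> by simp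
  moreover have "word_perm (word_of qs' R) (letter p) = a \<and> word_perm (word_of qs' R) (letter p + 1) = b"
    if "rev (positions n) = qs' @ p # rs'" for qs' rs'
    using suffix[OF that] inv by simp
  ultimately show "p \<in> absorbed id (rev (positions n)) R \<longleftrightarrow> b < a"
    unfolding mem_absorbed_iff id_comp using p(2) by metis
qed

lemma absorbed_eq:
  shows "absorbed id (positions n) R = rabs n R" and "absorbed id (rev (positions n)) R = labs n R"
proof -
  have "((i, j) \<in> absorbed id (positions n) R \<longleftrightarrow> (i, j) \<in> rabs n R) \<and>
    ((i, j) \<in> absorbed id (rev (positions n)) R \<longleftrightarrow> (i, j) \<in> labs n R)" for i j
  proof (cases "(i, j) \<in> staircase n - R")
    case True
    then have p: "(i, j) \<in> staircase n" "(i, j) \<notin> R" and ij: "1 \<le> i" "1 \<le> j" by (auto simp: staircase_def)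
    obtain a b where a: "tail_perm n R (i, j) a = i + j - 1" and b: "tail_perm n R (i, j) b = i + j"
      using bij_is_surj[OF bij_tail_perm] by (metis surjD)
    show ?thesis
      using mem_absorbed_positions_iff[OF p, of a b] mem_rabs_iff[OF p a b] mem_labs_iff[OF p a b] a b ij by simp
  next
    case False
    have "absorbed id (positions n) R \<subseteq> staircase n - R" "absorbed id (rev (positions n)) R \<subseteq> staircase n - R"
      using absorbed_subset[of id "positions n" R] absorbed_subset[of id "rev (positions n)" R]
      by (auto simp: set_positions mem_absorbed_iff)
    moreover have "rabs n R \<subseteq> staircase n - R" "labs n R \<subseteq> staircase n - R"
      by (auto simp: rabs_def labs_def)
    ultimately show ?thesis
      using False by blast
  qed
  then show "absorbed id (positions n) R = rabs n R" and "absorbed id (rev (positions n)) R = labs n R"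
    by auto
qed

end

lemma rising_subsets_rev:
  assumes w: "w permutes {1..n}"
  shows "rising_subsets id (rev (positions n)) (inv w) = rising_subsets id (positions n) w"
proof -
  have "reduced_word n (inv w) (rev as) \<longleftrightarrow> reduced_word n w as" for as
    using reduced_word_rev[of n w as] reduced_word_rev[of n "inv w" "rev as"] permutes_inv_inv[OF w] by auto
  then have "rising id (rev (word_of (positions n) R)) \<and> word_perm (rev (word_of (positions n) R)) = inv w \<longleftrightarrow>
      rising id (word_of (positions n) R) \<and> word_perm (word_of (positions n) R) = w" for R
    using letters_positions[of n R]
    unfolding reduced_word_iff_rising[OF w] reduced_word_iff_rising[OF permutes_inv[OF w]]
    by (metis set_rev)
  then show ?thesis
    by (simp add: rising_subsets_def word_of_rev)
qed

lemma subword_sum_rev: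
  assumes w: "w permutes {1..n}"
  shows "subword_sum n w = expect xy_weight (rev (positions n)) (point (inv w)) id"
proof -
  have "subword_sum n w = expect xy_weight (rev (positions n)) (\<lambda>v. point w (inv v)) id"
    unfolding subword_sum_def by (rule expect_rev[symmetric])
  also have "\<dots> = expect xy_weight (rev (positions n)) (point (inv w)) id"
  proof (rule expect_cong_bij)
    fix v :: "nat \<Rightarrow> nat"
    assume "bij v"
    then have "inv v = w \<longleftrightarrow> v = inv w"
      using permutes_bij[OF w] inv_inv_eq by metis
    then show "point w (inv v) = (point (inv w) v :: xypoly)"
      by (simp add: point_def)
  qed simp
  finally show ?thesis .
qed

theorem corollary6p14:
  fixes n :: nat and w :: "nat \<Rightarrow> nat"
  assumes "w permutes {1..n}"
  shows "H_poly n w =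
      (\<Sum>R\<in>rc_graphs n w.
        (\<Prod>(i, j)\<in>R. xv i + yv j - xv i * yv j) *
        (\<Prod>(i, j)\<in>staircase n - (R \<union> rabs n R). (1 - xv i) * (1 - yv j)))
    \<and> H_poly n w =
      (\<Sum>R\<in>rc_graphs n w.
        (\<Prod>(i, j)\<in>R. xv i + yv j - xv i * yv j) *
        (\<Prod>(i, j)\<in>staircase n - (R \<union> labs n R). (1 - xv i) * (1 - yv j)))"
proof -
  have cross: "(\<lambda>(i, j). xv i + yv j - xv i * yv j) = xy_weight"
    by (simp add: weight_def)
  have avoid: "(\<lambda>(i, j). (1 - xv i) * (1 - yv j)) = (\<lambda>p. 1 - xy_weight p)"
    by (auto simp: weight_def fun_eq_iff algebra_simps)
  have graphs: "rc_graphs n w = rising_subsets id (positions n) w"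
    by (rule rc_graphs_eq_rising_subsets[OF assms])
  have absorbed: "absorbed id (positions n) R = rabs n R" "absorbed id (rev (positions n)) R = labs n R"
    if "R \<in> rising_subsets id (positions n) w" for R
  proof -
    have "R \<subseteq> staircase n" "rising id (word_of (positions n) R)" "word_perm (word_of (positions n) R) = w"
      using that by (simp_all add: rising_subsets_def set_positions)
    note R = this
    show "absorbed id (positions n) R = rabs n R"
      by (rule absorbed_eq(1)[OF R])
    show "absorbed id (rev (positions n)) R = labs n R"
      by (rule absorbed_eq(2)[OF R])
  qed
  have "H_poly n w = (\<Sum>R\<in>rising_subsets id (positions n) w. (\<Prod>p\<in>R. xy_weight p) *
      (\<Prod>p\<in>staircase n - (R \<union> absorbed id (positions n) R). 1 - xy_weight p))"
    unfolding H_poly_eq_subword_sum[OF assms] subword_sum_def expect_point[OF distinct_positions inj_on_id] set_positions ..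
  moreover have "H_poly n w = (\<Sum>R\<in>rising_subsets id (positions n) w. (\<Prod>p\<in>R. xy_weight p) *
      (\<Prod>p\<in>staircase n - (R \<union> absorbed id (rev (positions n)) R). 1 - xy_weight p))"
    unfolding H_poly_eq_subword_sum[OF assms] subword_sum_rev[OF assms] rising_subsets_rev[OF assms, symmetric]
    by (subst expect_point) (simp_all add: distinct_positions set_positions)
  ultimately show ?thesis
    unfolding graphs cross avoid using absorbed by (auto cong: sum.cong)
qed

end
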